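(* Let $\Sigma\subset\mathbb{R}^4=\mathbb{H}$ be an oriented regular hypersurface with induced metric $g_\Sigma$ and unit normal $\nu:\Sigma\to\mathbb{S}^3$. Then for every $p\in\Sigma$, left quaternionic multiplication by $\nu_p$ gives an isometric isomorphism $T_p\Sigma\to\mathrm{Im}\,\mathbb{H}$. The maps $$T_p\Sigma\to\mathrm{End}^R_{\mathbb{H}}(\mathbb{H}),\qquad v\mapsto\bigl(q\mapsto\nu_p\cdot v\cdot q\bigr)$$ give an action of $C\ell(T\Sigma,g_\Sigma)$ on the trivial bundle $\underline{\mathbb{H}}\to\Sigma$ which, with the metric $\mathrm{Re}(\overline{q}w)$ and the right action of $\mathbb{H}$ by multiplication, makes $\underline{\mathbb{H}}$ a bundle of irreducible $C\ell(T\Sigma,g_\Sigma)$-$\mathbb{H}$-bimodules for which Clifford multiplication by tangent vectors and right multiplication by imaginary quaternions are skew-adjoint. In particular every oriented hypersurface of $\mathbb{R}^4$ admits a spin structure. Moreover, left quaternionic multiplication by $\nu$ gives a global trivialization of the tangent bundle of $\Sigma$.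
   Context: $C\ell(T\Sigma,g_\Sigma)$ is the bundle of real Clifford algebras with relations $v\cdot w+w\cdot v=-2g_\Sigma(v,w)$. $\mathbb{R}^4$ is identified with the quaternions $\mathbb{H}$ with its standard Euclidean metric, and $\mathrm{Im}\,\mathbb{H}$ is the space of imaginary quaternions. $\mathrm{End}^R_{\mathbb{H}}(\mathbb{H})$ denotes right $\mathbb{H}$-linear endomorphisms of $\mathbb{H}$. A spin structure on $\Sigma$ is a principal $Spin(3)$-bundle with a fibered double covering of the oriented orthonormal frame bundle of $T\Sigma$, equivariant with respect to the double cover $Spin(3)\to SO(3)$.
   Formalization: Left multiplication by the unit normal ν_p is replaced throughout by left multiplication by its conjugate (its inverse); with ν_p itself the claim fails, e.g. for the hyperplane orthogonal to (3+4i)/5, where ν·v is not imaginary for v=(4−3i)/5. *)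

theory Defs
  imports "HOL-Analysis.Analysis" "HOL-Algebra.QuotRing"
begin

section \<open>Quaternions\<close>

text \<open>
  The quaternions are \<^typ>\<open>real^4\<close> itself, with coordinates with respect to \<open>1, i, j, k\<close>; the
  Euclidean metric, norm and topology are those of the library. The product is a new operation,
  because \<open>*\<close> on \<^typ>\<open>real^4\<close> is the componentwise product.
\<close>

type_synonym quat = "real^4"

definition Quat :: "real \<Rightarrow> real \<Rightarrow> real \<Rightarrow> real \<Rightarrow> quat" where
  "Quat a b c d = (\<chi> m. if m = 1 then a else if m = 2 then b else if m = 3 then c else d)"

definition qmult :: "quat \<Rightarrow> quat \<Rightarrow> quat"  (infixl \<open>\<cdot>\<^sub>H\<close> 70) where
  "x \<cdot>\<^sub>H y = Quat
     (x$1 * y$1 - x$2 * y$2 - x$3 * y$3 - x$4 * y$4)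
     (x$1 * y$2 + x$2 * y$1 + x$3 * y$4 - x$4 * y$3)
     (x$1 * y$3 - x$2 * y$4 + x$3 * y$1 + x$4 * y$2)
     (x$1 * y$4 + x$2 * y$3 - x$3 * y$2 + x$4 * y$1)"

definition qone :: quat where "qone = Quat 1 0 0 0"

definition qcnj :: "quat \<Rightarrow> quat" where "qcnj x = Quat (x$1) (- x$2) (- x$3) (- x$4)"

definition qRe :: "quat \<Rightarrow> real" where "qRe x = x$1"

definition ImH :: "quat set" where "ImH = {x. qRe x = 0}"

definition qmetric :: "quat \<Rightarrow> quat \<Rightarrow> real" where "qmetric q w = qRe (qcnj q \<cdot>\<^sub>H w)"

lemma Quat_nth [simp]:
  "Quat a b c d $ 1 = a" "Quat a b c d $ 2 = b" "Quat a b c d $ 3 = c" "Quat a b c d $ 4 = d"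
  by (simp_all add: Quat_def)

text \<open>
  For a unit vector \<open>n\<close> and \<open>v\<close> orthogonal to \<open>n\<close> it is the product \<open>qcnj n \<cdot>\<^sub>H v\<close> that is
  imaginary. The product \<open>n \<cdot>\<^sub>H v\<close> is imaginary if and only if \<open>v\<close> is orthogonal to \<open>qcnj n\<close>,
  and in general it neither lies in \<^const>\<open>ImH\<close> nor squares to \<open>- (v \<bullet> v)\<close>, as the last lemma
  shows for a suitable hyperplane. Hence left multiplication by a unit normal \<open>\<nu>\<close> has to be read
  as multiplication by \<open>qcnj (\<nu> p)\<close>, the inverse of \<open>\<nu> p\<close>.
\<close>

lemma qRe_qcnj_qmult: "qRe (qcnj n \<cdot>\<^sub>H v) = n \<bullet> v"
  by (simp add: qRe_def qcnj_def qmult_def inner_vec_def sum_4)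

lemma qRe_qmult: "qRe (n \<cdot>\<^sub>H v) = qcnj n \<bullet> v"
  by (simp add: qRe_def qcnj_def qmult_def inner_vec_def sum_4)

lemma left_mult_by_normal_not_imaginary:
  "\<exists>n v. norm n = 1 \<and> n \<bullet> v = 0 \<and> n \<cdot>\<^sub>H v \<notin> ImH \<and>
         (n \<cdot>\<^sub>H v) \<cdot>\<^sub>H (n \<cdot>\<^sub>H v) \<noteq> - (v \<bullet> v) *\<^sub>R qone"
proof (intro exI conjI)
  let ?n = "Quat (3/5) (4/5) 0 0" and ?v = "Quat (4/5) (-3/5) 0 0"
  show "norm ?n = 1"
    by (simp add: norm_eq_sqrt_inner inner_vec_def sum_4)
  show "?n \<bullet> ?v = 0"
    by (simp add: inner_vec_def sum_4)
  show "?n \<cdot>\<^sub>H ?v \<notin> ImH"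
    by (simp add: ImH_def qRe_def qmult_def)
  have "((?n \<cdot>\<^sub>H ?v) \<cdot>\<^sub>H (?n \<cdot>\<^sub>H ?v)) $ 2 \<noteq> (- (?v \<bullet> ?v) *\<^sub>R qone) $ 2"
    by (simp add: qmult_def qone_def)
  then show "(?n \<cdot>\<^sub>H ?v) \<cdot>\<^sub>H (?n \<cdot>\<^sub>H ?v) \<noteq> - (?v \<bullet> ?v) *\<^sub>R qone"
    by metis
qed


section \<open>Smooth maps between subsets of Euclidean spaces\<close>

text \<open>\<open>C_on k U f\<close> means that \<open>f\<close> is \<open>C\<^sup>k\<close> on \<open>U\<close>; it is meant for open \<open>U\<close> only.\<close>

primrec C_on :: "nat \<Rightarrow> 'a::euclidean_space set \<Rightarrow> ('a \<Rightarrow> 'b::real_normed_vector) \<Rightarrow> bool" where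
  "C_on 0 U f \<longleftrightarrow> continuous_on U f"
| "C_on (Suc k) U f \<longleftrightarrow> (\<forall>x\<in>U. f differentiable (at x)) \<and>
     (\<forall>v. C_on k U (\<lambda>x. frechet_derivative f (at x) v))"

text \<open>On an arbitrary subset: local existence of smooth extensions to open subsets.\<close>

definition smooth_map :: "'a::euclidean_space set \<Rightarrow> ('a \<Rightarrow> 'b::real_normed_vector) \<Rightarrow> bool" where
  "smooth_map A f \<longleftrightarrow> (\<forall>x\<in>A. \<exists>U F. open U \<and> x \<in> U \<and> (\<forall>k. C_on k U F) \<and> (\<forall>y\<in>A \<inter> U. F y = f y))"

definition diffeomorphism ::
    "'a::euclidean_space set \<Rightarrow> 'b::euclidean_space set \<Rightarrow> ('a \<Rightarrow> 'b) \<Rightarrow> ('b \<Rightarrow> 'a) \<Rightarrow> bool" where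
  "diffeomorphism A B f g \<longleftrightarrow> smooth_map A f \<and> smooth_map B g \<and> f ` A = B \<and> g ` B = A \<and>
     (\<forall>x\<in>A. g (f x) = x) \<and> (\<forall>y\<in>B. f (g y) = y)"


section \<open>Oriented hypersurfaces of \<open>\<real>\<^sup>4\<close>\<close>

definition regular_hypersurface :: "quat set \<Rightarrow> bool" where
  "regular_hypersurface \<Sigma> \<longleftrightarrow>
     (\<forall>p\<in>\<Sigma>. \<exists>(W :: (real^3) set) V X Y.
        open W \<and> p \<in> V \<and> openin (top_of_set \<Sigma>) V \<and>
        smooth_map W X \<and> homeomorphism W V X Y \<and>
        (\<forall>u\<in>W. inj (frechet_derivative X (at u))))"

definition tangent_space :: "quat set \<Rightarrow> quat \<Rightarrow> quat set" where
  "tangent_space \<Sigma> p = {v. \<exists>\<gamma> \<epsilon>. \<epsilon> > 0 \<and> smooth_map {-\<epsilon><..<\<epsilon>} \<gamma> \<and> \<gamma> ` {-\<epsilon><..<\<epsilon>} \<subseteq> \<Sigma> \<and>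
     \<gamma> 0 = p \<and> (\<gamma> has_vector_derivative v) (at (0::real))}"

definition tangent_bundle :: "quat set \<Rightarrow> (quat \<times> quat) set" where
  "tangent_bundle \<Sigma> = {(p, v). p \<in> \<Sigma> \<and> v \<in> tangent_space \<Sigma> p}"

text \<open>
  An oriented hypersurface is given by the hypersurface and the smooth unit normal field that
  determines its orientation. The induced metric is the restriction of the Euclidean
  metric \<open>\<bullet>\<close> to the tangent spaces.
\<close>

definition oriented_hypersurface :: "quat set \<Rightarrow> (quat \<Rightarrow> quat) \<Rightarrow> bool" where
  "oriented_hypersurface \<Sigma> \<nu> \<longleftrightarrow> regular_hypersurface \<Sigma> \<and> smooth_map \<Sigma> \<nu> \<and>
     (\<forall>p\<in>\<Sigma>. norm (\<nu> p) = 1 \<and> (\<forall>v\<in>tangent_space \<Sigma> p. \<nu> p \<bullet> v = 0))"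

definition isometric_isomorphism ::
    "'a::real_inner set \<Rightarrow> 'b::real_inner set \<Rightarrow> ('a \<Rightarrow> 'b) \<Rightarrow> bool" where
  "isometric_isomorphism V W f \<longleftrightarrow> subspace V \<and> subspace W \<and> linear f \<and> bij_betw f V W \<and>
     (\<forall>v\<in>V. \<forall>w\<in>V. f v \<bullet> f w = v \<bullet> w)"

text \<open>The family \<open>f p\<close> of fibrewise maps trivializes \<open>T\<Sigma>\<close> with typical fibre \<open>F\<close>.\<close>

definition global_trivialization ::
    "quat set \<Rightarrow> 'b::euclidean_space set \<Rightarrow> (quat \<Rightarrow> quat \<Rightarrow> 'b) \<Rightarrow> bool" where
  "global_trivialization \<Sigma> F f \<longleftrightarrow>
     (\<forall>p\<in>\<Sigma>. subspace (tangent_space \<Sigma> p) \<and> linear (f p)) \<and> subspace F \<and>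
     (\<exists>\<Psi>. diffeomorphism (tangent_bundle \<Sigma>) (\<Sigma> \<times> F) (\<lambda>(p, v). (p, f p v)) \<Psi>)"


section \<open>Clifford algebras\<close>

text \<open>
  The free unital real algebra on the set \<open>V\<close>: finite linear combinations of words in \<open>V\<close>, with
  concatenation of words as product. The Clifford algebra of \<open>(V, g)\<close> is the quotient by the
  two-sided ideal generated by linearity of \<open>v \<mapsto> [v]\<close> and by the Clifford relations. (This is
  the tensor algebra of \<open>V\<close> modulo the Clifford relations.)
\<close>

definition free_algebra :: "'a set \<Rightarrow> ('a list \<Rightarrow> real) ring" where
  "free_algebra V = \<lparr>carrier = {x. finite {w. x w \<noteq> 0} \<and> (\<forall>w. x w \<noteq> 0 \<longrightarrow> set w \<subseteq> V)},
     mult = (\<lambda>x y w. \<Sum>n\<le>length w. x (take n w) * y (drop n w)),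
     one = (\<lambda>w. if w = [] then 1 else 0),
     zero = (\<lambda>w. 0),
     add = (\<lambda>x y w. x w + y w)\<rparr>"

definition monomial :: "real \<Rightarrow> 'a list \<Rightarrow> 'a list \<Rightarrow> real" where
  "monomial r u = (\<lambda>w. if w = u then r else 0)"

definition clifford_relations ::
    "'a::real_vector set \<Rightarrow> ('a \<Rightarrow> 'a \<Rightarrow> real) \<Rightarrow> ('a list \<Rightarrow> real) set" where
  "clifford_relations V g =
     {(\<lambda>u. monomial 1 [v + w] u - monomial 1 [v] u - monomial 1 [w] u) | v w. v \<in> V \<and> w \<in> V} \<union>
     {(\<lambda>u. monomial 1 [r *\<^sub>R v] u - monomial r [v] u) | r v. v \<in> V} \<union>
     {(\<lambda>u. monomial 1 [v, w] u + monomial 1 [w, v] u + monomial (2 * g v w) [] u) | v w.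
        v \<in> V \<and> w \<in> V}"

definition clifford_ideal ::
    "'a::real_vector set \<Rightarrow> ('a \<Rightarrow> 'a \<Rightarrow> real) \<Rightarrow> ('a list \<Rightarrow> real) set" where
  "clifford_ideal V g = Idl\<^bsub>free_algebra V\<^esub> (clifford_relations V g)"

definition clifford_algebra ::
    "'a::real_vector set \<Rightarrow> ('a \<Rightarrow> 'a \<Rightarrow> real) \<Rightarrow> ('a list \<Rightarrow> real) set ring" where
  "clifford_algebra V g = free_algebra V Quot clifford_ideal V g"

definition clifford_vec ::
    "'a::real_vector set \<Rightarrow> ('a \<Rightarrow> 'a \<Rightarrow> real) \<Rightarrow> 'a \<Rightarrow> ('a list \<Rightarrow> real) set" where
  "clifford_vec V g v = clifford_ideal V g +>\<^bsub>free_algebra V\<^esub> monomial 1 [v]"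

definition clifford_scalar ::
    "'a::real_vector set \<Rightarrow> ('a \<Rightarrow> 'a \<Rightarrow> real) \<Rightarrow> real \<Rightarrow> ('a list \<Rightarrow> real) set" where
  "clifford_scalar V g r = clifford_ideal V g +>\<^bsub>free_algebra V\<^esub> monomial r []"


section \<open>Clifford-quaternion bimodules\<close>

definition right_H_module :: "('w::real_vector \<Rightarrow> quat \<Rightarrow> 'w) \<Rightarrow> bool" where
  "right_H_module act \<longleftrightarrow> bilinear act \<and> (\<forall>x. act x qone = x) \<and>
     (\<forall>x h k. act (act x h) k = act x (h \<cdot>\<^sub>H k))"

text \<open>For \<open>act = (\<cdot>\<^sub>H)\<close> this is the algebra of right \<open>H\<close>-linear endomorphisms of \<open>H\<close>.\<close>

definition End_H :: "('w::real_vector \<Rightarrow> quat \<Rightarrow> 'w) \<Rightarrow> ('w \<Rightarrow> 'w) ring" where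
  "End_H act = \<lparr>carrier = {f. linear f \<and> (\<forall>x h. f (act x h) = act (f x) h)},
     mult = (\<circ>), one = id, zero = (\<lambda>x. 0), add = (\<lambda>f g x. f x + g x)\<rparr>"

text \<open>
  The left action \<open>\<rho>\<close> is a homomorphism of unital real algebras into the right \<open>H\<close>-linear
  endomorphisms, i.e. both actions are real linear and commute.
\<close>

definition clifford_bimodule ::
    "'a::real_vector set \<Rightarrow> ('a \<Rightarrow> 'a \<Rightarrow> real) \<Rightarrow> (('a list \<Rightarrow> real) set \<Rightarrow> 'w \<Rightarrow> 'w) \<Rightarrow>
     ('w::real_vector \<Rightarrow> quat \<Rightarrow> 'w) \<Rightarrow> bool" where
  "clifford_bimodule V g \<rho> act \<longleftrightarrow> right_H_module act \<and>
     \<rho> \<in> ring_hom (clifford_algebra V g) (End_H act) \<and>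
     (\<forall>r. \<rho> (clifford_scalar V g r) = (\<lambda>x. r *\<^sub>R x))"

definition irreducible_clifford_bimodule ::
    "'a::real_vector set \<Rightarrow> ('a \<Rightarrow> 'a \<Rightarrow> real) \<Rightarrow> (('a list \<Rightarrow> real) set \<Rightarrow> 'w \<Rightarrow> 'w) \<Rightarrow>
     ('w::real_vector \<Rightarrow> quat \<Rightarrow> 'w) \<Rightarrow> bool" where
  "irreducible_clifford_bimodule V g \<rho> act \<longleftrightarrow> clifford_bimodule V g \<rho> act \<and>
     (UNIV :: 'w set) \<noteq> {0} \<and>
     (\<forall>S. subspace S \<and> (\<forall>a\<in>carrier (clifford_algebra V g). \<rho> a ` S \<subseteq> S) \<and>
          (\<forall>x\<in>S. \<forall>h. act x h \<in> S) \<longrightarrow> S = {0} \<or> S = UNIV)"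

text \<open>
  A bundle of irreducible bimodules over the Clifford bundle of \<open>(T\<Sigma>, \<bullet>)\<close>, with the trivial bundle
  \<open>\<Sigma> \<times> 'w\<close> as underlying vector bundle and the same right action on all fibres. As smooth
  sections of the Clifford bundle are locally smooth combinations of products of smooth vector
  fields, smoothness of the left action is required for tangent vectors.
\<close>

definition irreducible_clifford_bimodule_bundle ::
    "quat set \<Rightarrow> (quat \<Rightarrow> (quat list \<Rightarrow> real) set \<Rightarrow> 'w \<Rightarrow> 'w) \<Rightarrow>
     ('w::euclidean_space \<Rightarrow> quat \<Rightarrow> 'w) \<Rightarrow> bool" where
  "irreducible_clifford_bimodule_bundle \<Sigma> \<rho> act \<longleftrightarrow>
     (\<forall>p\<in>\<Sigma>. irreducible_clifford_bimodule (tangent_space \<Sigma> p) (\<bullet>) (\<rho> p) act) \<and>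
     smooth_map {(p, v, x). p \<in> \<Sigma> \<and> v \<in> tangent_space \<Sigma> p}
       (\<lambda>(p, v, x). \<rho> p (clifford_vec (tangent_space \<Sigma> p) (\<bullet>) v) x)"

definition inner_product :: "('w::real_vector \<Rightarrow> 'w \<Rightarrow> real) \<Rightarrow> bool" where
  "inner_product h \<longleftrightarrow> bilinear h \<and> (\<forall>x y. h x y = h y x) \<and> (\<forall>x. x \<noteq> 0 \<longrightarrow> h x x > 0)"

definition skew_adjoint :: "('w \<Rightarrow> 'w \<Rightarrow> real) \<Rightarrow> ('w \<Rightarrow> 'w) \<Rightarrow> bool" where
  "skew_adjoint h f \<longleftrightarrow> (\<forall>x y. h (f x) y = - h x (f y))"


section \<open>Spin structures\<close>

text \<open>
  Spin(3) is realized as the group of unit quaternions, and its double cover of SO(3) is the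
  conjugation action on the imaginary quaternions, written as a matrix in the basis \<open>i, j, k\<close>.
\<close>

definition Spin3 :: "quat set" where "Spin3 = {g. norm g = 1}"

definition im_embed :: "real^3 \<Rightarrow> quat" where "im_embed x = Quat 0 (x$1) (x$2) (x$3)"

definition im_part :: "quat \<Rightarrow> real^3" where "im_part q = vector [q$2, q$3, q$4]"

definition spin_cover :: "quat \<Rightarrow> real^3^3" where
  "spin_cover g = matrix (\<lambda>x. im_part (g \<cdot>\<^sub>H im_embed x \<cdot>\<^sub>H qcnj g))"

text \<open>
  A frame at \<open>p\<close> is a triple \<open>e $ 1, e $ 2, e $ 3\<close>; an orthonormal frame \<open>e\<close> of the tangent space
  is oriented iff \<open>\<nu> p, e $ 1, e $ 2, e $ 3\<close> is a positively oriented basis of \<open>\<real>\<^sup>4\<close>.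
\<close>

definition oriented_frame_bundle :: "quat set \<Rightarrow> (quat \<Rightarrow> quat) \<Rightarrow> (quat \<times> (quat^3)) set" where
  "oriented_frame_bundle \<Sigma> \<nu> = {(p, e). p \<in> \<Sigma> \<and> (\<forall>m. e $ m \<in> tangent_space \<Sigma> p) \<and>
     (\<forall>m n. e $ m \<bullet> e $ n = (if m = n then 1 else 0)) \<and>
     det ((\<chi> m. if m = 1 then \<nu> p else if m = 2 then e $ 1 else if m = 3 then e $ 2 else e $ 3)
          :: real^4^4) > 0}"

definition frame_act :: "quat \<times> (quat^3) \<Rightarrow> real^3^3 \<Rightarrow> quat \<times> (quat^3)" where
  "frame_act f A = (fst f, \<chi> n. \<Sum>m\<in>UNIV. A $ m $ n *\<^sub>R snd f $ m)"

text \<open>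
  Total spaces are taken to be subsets of Euclidean spaces. Together with local triviality, this
  makes them embedded submanifolds; by Whitney's theorem there is no loss of generality.
\<close>

definition principal_Spin3_bundle ::
    "quat set \<Rightarrow> 'e::euclidean_space set \<Rightarrow> ('e \<Rightarrow> quat) \<Rightarrow> ('e \<Rightarrow> quat \<Rightarrow> 'e) \<Rightarrow> bool" where
  "principal_Spin3_bundle B P \<pi> act \<longleftrightarrow>
     smooth_map P \<pi> \<and> \<pi> ` P = B \<and>
     smooth_map (P \<times> Spin3) (\<lambda>(u, g). act u g) \<and>
     (\<forall>u\<in>P. act u qone = u) \<and>
     (\<forall>u\<in>P. \<forall>g\<in>Spin3. act u g \<in> P \<and> \<pi> (act u g) = \<pi> u) \<and>
     (\<forall>u\<in>P. \<forall>g\<in>Spin3. \<forall>h\<in>Spin3. act (act u g) h = act u (g \<cdot>\<^sub>H h)) \<and>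
     (\<forall>b\<in>B. \<exists>U \<Phi> \<Psi>. b \<in> U \<and> openin (top_of_set B) U \<and>
        diffeomorphism (P \<inter> \<pi> -` U) (U \<times> Spin3) \<Phi> \<Psi> \<and>
        (\<forall>u\<in>P \<inter> \<pi> -` U. fst (\<Phi> u) = \<pi> u \<and>
           (\<forall>g\<in>Spin3. snd (\<Phi> (act u g)) = snd (\<Phi> u) \<cdot>\<^sub>H g)))"

definition spin_structure ::
    "quat set \<Rightarrow> (quat \<Rightarrow> quat) \<Rightarrow> 'e::euclidean_space set \<Rightarrow> ('e \<Rightarrow> quat) \<Rightarrow>
     ('e \<Rightarrow> quat \<Rightarrow> 'e) \<Rightarrow> ('e \<Rightarrow> quat \<times> (quat^3)) \<Rightarrow> bool" where
  "spin_structure \<Sigma> \<nu> P \<pi> act \<eta> \<longleftrightarrow>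
     principal_Spin3_bundle \<Sigma> P \<pi> act \<and>
     smooth_map P \<eta> \<and> covering_space P \<eta> (oriented_frame_bundle \<Sigma> \<nu>) \<and>
     (\<forall>f\<in>oriented_frame_bundle \<Sigma> \<nu>. card {u\<in>P. \<eta> u = f} = 2) \<and>
     (\<forall>u\<in>P. fst (\<eta> u) = \<pi> u) \<and>
     (\<forall>u\<in>P. \<forall>g\<in>Spin3. \<eta> (act u g) = frame_act (\<eta> u) (spin_cover g))"

end

theory Submission
  imports Defs
begin

text \<open>
  Everything rests on the isometry \<open>v \<mapsto> qcnj (\<nu> p) \<cdot>\<^sub>H v\<close>. Multiplication by a unit quaternion is
  orthogonal, and \<open>qRe (qcnj (\<nu> p) \<cdot>\<^sub>H v) = \<nu> p \<bullet> v\<close>, so this map carries the hyperplane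
  \<open>{v. \<nu> p \<bullet> v = 0}\<close> isometrically onto \<^const>\<open>ImH\<close>. The tangent space is that hyperplane
  (\<open>tangent_space_eq_hyperplane\<close>): a chart provides three independent velocities, all of which
  are orthogonal to \<open>\<nu> p\<close>, so dimensions agree. As \<open>\<nu>\<close> is smooth and the inverse is multiplication
  by \<open>\<nu> p\<close>, this already trivializes the tangent bundle (\<open>trivialization_by_normal\<close>).

  Imaginary quaternions satisfy \<open>a b + b a = - 2 (a \<bullet> b)\<close>. Hence left multiplication by
  \<open>qcnj (\<nu> p) \<cdot>\<^sub>H v\<close> satisfies the Clifford relations, and by the universal property of the Clifford
  algebra (\<open>clifford_algebra_lift\<close>) it extends to an action, which commutes with right
  multiplication by associativity. Irreducibility uses the right action alone: the quaternions
  are a division algebra, so their only right ideals are \<open>{0}\<close> and the whole algebra.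

  The spin structure is the trivial bundle \<open>\<Sigma> \<times> S\<^sup>3\<close>. A unit quaternion \<open>g\<close> over \<open>p\<close> is sent to the
  frame \<open>\<nu> p \<cdot>\<^sub>H (g \<cdot>\<^sub>H e\<^sub>m \<cdot>\<^sub>H qcnj g)\<close>, where \<open>e\<^sub>1, e\<^sub>2, e\<^sub>3\<close> are the imaginary units. To see that this
  is a double covering of the oriented orthonormal frames, one recovers \<open>g\<close> from the triad
  \<open>f\<^sub>m = g \<cdot>\<^sub>H e\<^sub>m \<cdot>\<^sub>H qcnj g\<close> by the averaging formula
  \<open>a + \<Sum>\<^sub>m f\<^sub>m a (qcnj e\<^sub>m) = 4 (g \<bullet> a) g\<close>, valid for every quaternion \<open>a\<close>
  (\<open>triad_avg_rotated_triad\<close>). The left-hand side depends continuously on the triad, so it gives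
  local sections where it does not vanish; with \<open>a = g\<close> it shows that \<open>g\<close> is unique up to sign; and for
  an arbitrary oriented orthonormal triad it intertwines \<open>e\<^sub>m\<close> with \<open>f\<^sub>m\<close>, which gives surjectivity.
\<close>

section \<open>Quaternion algebra\<close>

lemmas quat_expand = vec_eq_iff forall_4 inner_vec_def sum_4 qmult_def qcnj_def qone_def qRe_def

lemma qmult_assoc: "(x \<cdot>\<^sub>H y) \<cdot>\<^sub>H z = x \<cdot>\<^sub>H (y \<cdot>\<^sub>H z)"
  by (simp add: quat_expand algebra_simps)

lemma qone_qmult [simp]: "qone \<cdot>\<^sub>H x = x" "x \<cdot>\<^sub>H qone = x"
  by (simp_all add: quat_expand)

lemma bilinear_qmult: "bilinear (\<cdot>\<^sub>H)"
  by (auto simp: bilinear_def intro!: linearI) (simp_all add: quat_expand algebra_simps)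

interpretation qmult: bounded_bilinear "(\<cdot>\<^sub>H)"
  using bilinear_qmult bilinear_conv_bounded_bilinear by blast

lemma bounded_linear_qcnj: "bounded_linear qcnj"
  by (simp add: linear_conv_bounded_linear [symmetric] linear_iff) (simp add: quat_expand)

lemma qcnj_qcnj [simp]: "qcnj (qcnj x) = x"
  by (simp add: quat_expand)

lemma qcnj_qmult: "qcnj (x \<cdot>\<^sub>H y) = qcnj y \<cdot>\<^sub>H qcnj x"
  by (simp add: quat_expand algebra_simps)

lemma qcnj_qmult_self: "qcnj x \<cdot>\<^sub>H x = (x \<bullet> x) *\<^sub>R qone" "x \<cdot>\<^sub>H qcnj x = (x \<bullet> x) *\<^sub>R qone"
  by (simp_all add: quat_expand algebra_simps)

text \<open>
  Left and right multiplications have adjoints of the same kind. This is the source of all statements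
  below about isometries, orthogonality and skew-adjointness.
\<close>

lemma qmult_adjoint:
  "(a \<cdot>\<^sub>H x) \<bullet> y = x \<bullet> (qcnj a \<cdot>\<^sub>H y)" "(x \<cdot>\<^sub>H a) \<bullet> y = x \<bullet> (y \<cdot>\<^sub>H qcnj a)"
  by (simp_all add: quat_expand algebra_simps)

lemma unit_qmult_cancel:
  assumes "norm u = 1"
  shows "qcnj u \<cdot>\<^sub>H (u \<cdot>\<^sub>H x) = x" "u \<cdot>\<^sub>H (qcnj u \<cdot>\<^sub>H x) = x" "x \<cdot>\<^sub>H u \<cdot>\<^sub>H qcnj u = x" "x \<cdot>\<^sub>H qcnj u \<cdot>\<^sub>H u = x"
  using assms
  by (simp_all add: qmult_assoc)
     (simp_all add: qmult_assoc [symmetric] qcnj_qmult_self qmult.scaleR_left qmult.scaleR_right dot_square_norm)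

lemma norm_qcnj [simp]: "norm (qcnj x) = norm x"
  by (simp add: norm_eq_sqrt_inner quat_expand)

lemma norm_qmult: "norm (x \<cdot>\<^sub>H y) = norm x * norm y"
proof -
  have "(x \<cdot>\<^sub>H y) \<bullet> (x \<cdot>\<^sub>H y) = (x \<bullet> x) * (y \<bullet> y)"
    by (simp add: qmult_adjoint qmult_assoc [symmetric] qcnj_qmult_self qmult.scaleR_left)
  then show ?thesis
    by (simp add: norm_eq_sqrt_inner real_sqrt_mult)
qed

lemma inner_unit_qmult:
  assumes "norm u = 1"
  shows "(u \<cdot>\<^sub>H x) \<bullet> (u \<cdot>\<^sub>H y) = x \<bullet> y" "(x \<cdot>\<^sub>H u) \<bullet> (y \<cdot>\<^sub>H u) = x \<bullet> y"
  by (simp_all only: qmult_adjoint(1)[of u] qmult_adjoint(2)[of _ u] unit_qmult_cancel assms)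

lemma qmetric_eq_inner: "qmetric = (\<bullet>)"
  by (simp add: fun_eq_iff qmetric_def qRe_qcnj_qmult)

text \<open>
  In this form membership can be checked by the rules for conjugation, without coordinates.
\<close>

lemma ImH_iff: "x \<in> ImH \<longleftrightarrow> qcnj x = - x"
  by (auto simp: ImH_def quat_expand)

lemma subspace_ImH: "subspace ImH"
  by (auto simp: subspace_def ImH_def qRe_def)

lemma ImH_qmult_self: "x \<in> ImH \<Longrightarrow> x \<cdot>\<^sub>H x = - (x \<bullet> x) *\<^sub>R qone"
  using qcnj_qmult_self(1)[of x] by (simp add: ImH_iff qmult.minus_left) (metis minus_minus)

lemma ImH_anticommute: "x \<in> ImH \<Longrightarrow> y \<in> ImH \<Longrightarrow> x \<cdot>\<^sub>H y + y \<cdot>\<^sub>H x = (- 2 * (x \<bullet> y)) *\<^sub>R qone"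
  by (simp add: ImH_def quat_expand)

section \<open>Calculus of smooth maps\<close>

lemma C_on_subset: "C_on k U f \<Longrightarrow> V \<subseteq> U \<Longrightarrow> C_on k V f"
proof (induction k arbitrary: f)
  case 0
  then show ?case
    unfolding C_on.simps by (rule continuous_on_subset)
next
  case (Suc k)
  have "C_on k V (\<lambda>x. frechet_derivative f (at x) v)" for v
    using Suc.prems by (intro Suc.IH) simp_all
  then show ?case
    using Suc.prems by (simp add: subset_iff)
qed

lemma C_on_cong:
  assumes "open U" "\<And>x. x \<in> U \<Longrightarrow> f x = g x"
  shows "C_on k U f \<longleftrightarrow> C_on k U g"
  using assms(2)
proof (induction k arbitrary: f g)
  case 0
  then show ?case
    by (simp cong: continuous_on_cong)
next
  case (Suc k)
  have eq: "(f has_derivative D) (at x) \<longleftrightarrow> (g has_derivative D) (at x)" if "x \<in> U" for x D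
    using has_derivative_transform_within_open[OF _ assms(1) that, of _ D UNIV g]
      has_derivative_transform_within_open[OF _ assms(1) that, of _ D UNIV f] Suc.prems
    by metis
  then have "frechet_derivative f (at x) = frechet_derivative g (at x)" if "x \<in> U" for x
    using that by (simp add: frechet_derivative_def)
  then have "C_on k U (\<lambda>x. frechet_derivative f (at x) v) \<longleftrightarrow>
             C_on k U (\<lambda>x. frechet_derivative g (at x) v)" for v
    by (intro Suc.IH) simp
  with eq show ?case
    by (simp add: differentiable_def)
qed

text \<open>
  \<^const>\<open>C_on\<close> speaks of the value picked by \<^const>\<open>frechet_derivative\<close>. This rule and
  \<open>C_on_Suc_derivative\<close> replace it by whatever derivative the differentiation rules produce, so
  that closure properties follow by induction on the order of differentiability.
\<close>

lemma C_on_SucI: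
  assumes "open U" "\<And>x. x \<in> U \<Longrightarrow> (f has_derivative f' x) (at x)"
    and "\<And>v. C_on k U (\<lambda>x. f' x v)"
  shows "C_on (Suc k) U f"
proof -
  have "C_on k U (\<lambda>x. frechet_derivative f (at x) v)" for v
    using assms(3)[of v] frechet_derivative_at[OF assms(2)]
    by (subst C_on_cong[OF assms(1), of _ "\<lambda>x. f' x v"]) auto
  with assms(2) show ?thesis
    by (auto simp: differentiable_def)
qed

lemma C_on_Suc_derivative:
  assumes "C_on (Suc k) U f"
  shows "\<exists>f'. (\<forall>x\<in>U. (f has_derivative f' x) (at x)) \<and> (\<forall>v. C_on k U (\<lambda>x. f' x v))"
proof (intro exI conjI ballI allI)
  show "(f has_derivative frechet_derivative f (at x)) (at x)" if "x \<in> U" for x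
    using assms that by (simp only: C_on.simps(2) frechet_derivative_works [symmetric])
  show "C_on k U (\<lambda>x. frechet_derivative f (at x) v)" for v
    using assms by (simp only: C_on.simps(2))
qed

lemma C_on_SucD: "C_on (Suc k) U f \<Longrightarrow> C_on k U f"
proof (induction k arbitrary: f)
  case 0
  then show ?case
    by (simp only: C_on.simps differentiable_at_imp_differentiable_on differentiable_imp_continuous_on)
next
  case (Suc k)
  have "\<forall>x\<in>U. f differentiable (at x)"
    using Suc.prems by simp
  moreover have "C_on k U (\<lambda>x. frechet_derivative f (at x) v)" for v
    using C_on.simps(2)[THEN iffD1, OF Suc.prems] by (blast intro: Suc.IH)
  ultimately show ?case
    by (subst C_on.simps(2)) blast
qed

lemma C_on_const: "open U \<Longrightarrow> C_on k U (\<lambda>x. c)"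
proof (induction k arbitrary: c)
  case (Suc k)
  then show ?case
    by (intro C_on_SucI[where f' = "\<lambda>x v. 0"]) auto
qed simp

lemma C_on_linear: "open U \<Longrightarrow> bounded_linear L \<Longrightarrow> C_on k U L"
proof (cases k)
  case (Suc l)
  assume "open U" "bounded_linear L"
  then show ?thesis
    unfolding Suc
    by (intro C_on_SucI[where f' = "\<lambda>x. L"] C_on_const bounded_linear_imp_has_derivative)
qed (simp add: linear_continuous_on)

lemma C_on_linear_comp:
  assumes "open U" "bounded_linear L" "C_on k U f"
  shows "C_on k U (\<lambda>x. L (f x))"
  using assms(3)
proof (induction k arbitrary: f)
  case 0
  then show ?case
    using assms(2) by (simp add: bounded_linear.continuous_on)
next
  case (Suc k)
  obtain f' where "\<And>x. x \<in> U \<Longrightarrow> (f has_derivative f' x) (at x)" "\<And>v. C_on k U (\<lambda>x. f' x v)"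
    using C_on_Suc_derivative[OF Suc.prems] by blast
  then show ?case
    by (intro C_on_SucI[OF assms(1) bounded_linear.has_derivative[OF assms(2)]] Suc.IH)
qed

lemma C_on_add:
  assumes "open U" "C_on k U f" "C_on k U g"
  shows "C_on k U (\<lambda>x. f x + g x)"
  using assms(2,3)
proof (induction k arbitrary: f g)
  case 0
  then show ?case by (simp add: continuous_on_add)
next
  case (Suc k)
  obtain f' where f': "\<And>x. x \<in> U \<Longrightarrow> (f has_derivative f' x) (at x)" "\<And>v. C_on k U (\<lambda>x. f' x v)"
    using C_on_Suc_derivative[OF Suc.prems(1)] by blast
  obtain g' where g': "\<And>x. x \<in> U \<Longrightarrow> (g has_derivative g' x) (at x)" "\<And>v. C_on k U (\<lambda>x. g' x v)"
    using C_on_Suc_derivative[OF Suc.prems(2)] by blast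
  show ?case
    by (rule C_on_SucI[OF assms(1) has_derivative_add[OF f'(1) g'(1)]])
       (simp_all add: Suc.IH[OF f'(2) g'(2)])
qed

text \<open>
  By the product rule, the derivative of \<open>h (f x) (g x)\<close> is a sum of two terms of the same form, with
  one factor differentiated; this is what makes the induction go through for all functions at once.
\<close>

lemma C_on_bilinear:
  assumes "open U" "bounded_bilinear h" "C_on k U f" "C_on k U g"
  shows "C_on k U (\<lambda>x. h (f x) (g x))"
  using assms(3,4)
proof (induction k arbitrary: f g)
  case 0
  then show ?case
    using assms(2) by (simp add: bounded_bilinear.continuous_on)
next
  case (Suc k)
  obtain f' where f': "\<And>x. x \<in> U \<Longrightarrow> (f has_derivative f' x) (at x)" "\<And>v. C_on k U (\<lambda>x. f' x v)"
    using C_on_Suc_derivative[OF Suc.prems(1)] by blast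
  obtain g' where g': "\<And>x. x \<in> U \<Longrightarrow> (g has_derivative g' x) (at x)" "\<And>v. C_on k U (\<lambda>x. g' x v)"
    using C_on_Suc_derivative[OF Suc.prems(2)] by blast
  show ?case
  proof (rule C_on_SucI[OF assms(1)])
    show "((\<lambda>x. h (f x) (g x)) has_derivative (\<lambda>v. h (f x) (g' x v) + h (f' x v) (g x))) (at x)"
      if "x \<in> U" for x
      by (rule bounded_bilinear.FDERIV[OF assms(2) f'(1)[OF that] g'(1)[OF that]])
    show "C_on k U (\<lambda>x. h (f x) (g' x v) + h (f' x v) (g x))" for v
      by (intro C_on_add[OF assms(1)] Suc.IH C_on_SucD[OF Suc.prems(1)] C_on_SucD[OF Suc.prems(2)] f' g')
  qed
qed

text \<open>
  Differentiating \<open>f \<circ> A\<close> for affine \<open>A\<close> with linear part \<open>L\<close> gives \<open>(\<lambda>y. f' y (L v)) \<circ> A\<close>, again a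
  composition with \<open>A\<close>. The substitutions that occur below are projections of
  products and straight lines in a chart, which are affine.
\<close>

lemma C_on_compose_affine:
  assumes "open U" "bounded_linear L" "C_on k U f"
  shows "C_on k {x. c + L x \<in> U} (\<lambda>x. f (c + L x))"
  using assms(3)
proof (induction k arbitrary: f)
  case 0
  then show ?case
    unfolding C_on.simps
    by (rule continuous_on_compose2
          [OF _ continuous_on_add[OF continuous_on_const linear_continuous_on[OF assms(2)]]]) auto
next
  case (Suc k)
  obtain f' where f': "\<And>x. x \<in> U \<Longrightarrow> (f has_derivative f' x) (at x)" "\<And>v. C_on k U (\<lambda>x. f' x v)"
    using C_on_Suc_derivative[OF Suc.prems(1)] by blast
  have "continuous_on UNIV (\<lambda>x. c + L x)"
    using assms(2) by (rule continuous_on_add[OF continuous_on_const linear_continuous_on])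
  then have "open {x. c + L x \<in> U}"
    using assms(1) open_vimage[of U "\<lambda>x. c + L x"] by (simp add: vimage_def)
  moreover have "((\<lambda>x. f (c + L x)) has_derivative (\<lambda>v. f' (c + L x) (L v))) (at x)"
    if "x \<in> {x. c + L x \<in> U}" for x
  proof -
    have "((\<lambda>x. c + L x) has_derivative L) (at x)"
      using has_derivative_add[OF has_derivative_const bounded_linear_imp_has_derivative[OF assms(2)]]
      by auto
    from has_derivative_compose[OF this f'(1)] that show ?thesis by simp
  qed
  moreover have "C_on k {x. c + L x \<in> U} (\<lambda>x. f' (c + L x) (L v))" for v
    using Suc.IH[OF f'(2)] .
  ultimately show ?case
    by (rule C_on_SucI)
qed

lemma smooth_map_cong: "(\<And>x. x \<in> A \<Longrightarrow> f x = g x) \<Longrightarrow> smooth_map A f \<longleftrightarrow> smooth_map A g"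
  by (auto simp: smooth_map_def)

lemma smooth_map_linear: "bounded_linear L \<Longrightarrow> smooth_map A L"
  unfolding smooth_map_def by (metis C_on_linear UNIV_I open_UNIV)

lemma smooth_map_linear_comp:
  assumes "bounded_linear L" "smooth_map A f"
  shows "smooth_map A (\<lambda>x. L (f x))"
  unfolding smooth_map_def
proof
  fix x assume x: "x \<in> A"
  obtain U F where "open U" "x \<in> U" "\<forall>k. C_on k U F" "\<forall>y\<in>A \<inter> U. F y = f y"
    using assms(2)[unfolded smooth_map_def, THEN bspec, OF x] by (elim exE conjE) (rule that)
  moreover from this have "C_on k U (\<lambda>y. L (F y))" for k
    using C_on_linear_comp[OF _ assms(1)] by blast
  ultimately show "\<exists>U F. open U \<and> x \<in> U \<and> (\<forall>k. C_on k U F) \<and> (\<forall>y\<in>A \<inter> U. F y = L (f y))"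
    by (intro exI[of _ U] exI[of _ "\<lambda>y. L (F y)"]) simp
qed

lemma smooth_map_bilinear:
  assumes "bounded_bilinear h" "smooth_map A f" "smooth_map A g"
  shows "smooth_map A (\<lambda>x. h (f x) (g x))"
  unfolding smooth_map_def
proof
  fix x assume x: "x \<in> A"
  obtain U F where U: "open U" "x \<in> U" "\<forall>k. C_on k U F" "\<forall>y\<in>A \<inter> U. F y = f y"
    using assms(2)[unfolded smooth_map_def, THEN bspec, OF x] by (elim exE conjE) (rule that)
  obtain V G where V: "open V" "x \<in> V" "\<forall>k. C_on k V G" "\<forall>y\<in>A \<inter> V. G y = g y"
    using assms(3)[unfolded smooth_map_def, THEN bspec, OF x] by (elim exE conjE) (rule that)
  have "C_on k (U \<inter> V) (\<lambda>y. h (F y) (G y))" for k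
    by (rule C_on_bilinear[OF open_Int[OF U(1) V(1)] assms(1)])
       (use U(3) V(3) in \<open>blast intro: C_on_subset\<close>)+
  with U(1,2,4) V(1,2,4) show "\<exists>U F. open U \<and> x \<in> U \<and> (\<forall>k. C_on k U F) \<and> (\<forall>y\<in>A \<inter> U. F y = h (f y) (g y))"
    by (intro exI[of _ "U \<inter> V"] exI[of _ "\<lambda>y. h (F y) (G y)"]) (simp add: open_Int)
qed

lemma smooth_map_add:
  assumes "smooth_map A f" "smooth_map A g"
  shows "smooth_map A (\<lambda>x. f x + g x)"
  unfolding smooth_map_def
proof
  fix x assume x: "x \<in> A"
  obtain U F where U: "open U" "x \<in> U" "\<forall>k. C_on k U F" "\<forall>y\<in>A \<inter> U. F y = f y"
    using assms(1)[unfolded smooth_map_def, THEN bspec, OF x] by (elim exE conjE) (rule that)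
  obtain V G where V: "open V" "x \<in> V" "\<forall>k. C_on k V G" "\<forall>y\<in>A \<inter> V. G y = g y"
    using assms(2)[unfolded smooth_map_def, THEN bspec, OF x] by (elim exE conjE) (rule that)
  have "C_on k (U \<inter> V) (\<lambda>y. F y + G y)" for k
    by (rule C_on_add[OF open_Int[OF U(1) V(1)]])
       (use U(3) V(3) in \<open>blast intro: C_on_subset\<close>)+
  with U(1,2,4) V(1,2,4) show "\<exists>U F. open U \<and> x \<in> U \<and> (\<forall>k. C_on k U F) \<and> (\<forall>y\<in>A \<inter> U. F y = f y + g y)"
    by (intro exI[of _ "U \<inter> V"] exI[of _ "\<lambda>y. F y + G y"]) (simp add: open_Int)
qed

lemma smooth_map_compose_affine:
  assumes "bounded_linear L" "smooth_map A f" "\<And>x. x \<in> B \<Longrightarrow> c + L x \<in> A"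
  shows "smooth_map B (\<lambda>x. f (c + L x))"
  unfolding smooth_map_def
proof
  fix x assume x: "x \<in> B"
  obtain U F where U: "open U" "c + L x \<in> U" "\<forall>k. C_on k U F" "\<forall>y\<in>A \<inter> U. F y = f y"
    using assms(2)[unfolded smooth_map_def, THEN bspec, OF assms(3)[OF x]] by (elim exE conjE) (rule that)
  have "continuous_on UNIV (\<lambda>x. c + L x)"
    using assms(1) by (rule continuous_on_add[OF continuous_on_const linear_continuous_on])
  then have "open {x. c + L x \<in> U}"
    using U(1) open_vimage[of U "\<lambda>x. c + L x"] by (simp add: vimage_def)
  show "\<exists>U F. open U \<and> x \<in> U \<and> (\<forall>k. C_on k U F) \<and> (\<forall>y\<in>B \<inter> U. F y = f (c + L y))"
  proof (rule exI[of _ "{x. c + L x \<in> U}"], rule exI[of _ "\<lambda>x. F (c + L x)"], intro conjI allI ballI)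
    show "open {x. c + L x \<in> U}" by fact
    show "x \<in> {x. c + L x \<in> U}" using U(2) by simp
    show "C_on k {x. c + L x \<in> U} (\<lambda>x. F (c + L x))" for k
      by (rule C_on_compose_affine[OF U(1) assms(1) U(3)[rule_format]])
    show "F (c + L y) = f (c + L y)" if "y \<in> B \<inter> {x. c + L x \<in> U}" for y
      by (rule U(4)[rule_format]) (use that assms(3) in simp)
  qed
qed

lemma smooth_map_compose_linear:
  assumes "bounded_linear L" "smooth_map A f" "\<And>x. x \<in> B \<Longrightarrow> L x \<in> A"
  shows "smooth_map B (\<lambda>x. f (L x))"
proof -
  have "smooth_map B (\<lambda>x. f (0 + L x))"
    by (rule smooth_map_compose_affine[OF assms(1,2)]) (simp add: assms(3))
  then show ?thesis by simp
qed

lemma smooth_map_Pair: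
  assumes "smooth_map A f" "smooth_map A g"
  shows "smooth_map A (\<lambda>x. (f x, g x))"
proof -
  have "bounded_linear (\<lambda>y. (y, 0))" "bounded_linear (\<lambda>y. (0, y))"
    by (intro bounded_linear_Pair bounded_linear_ident bounded_linear_zero)+
  then have "smooth_map A (\<lambda>x. (f x, 0) + (0, g x))"
    by (intro smooth_map_add smooth_map_linear_comp[OF _ assms(1)] smooth_map_linear_comp[OF _ assms(2)])
  then show ?thesis by simp
qed

lemma smooth_map_sum:
  assumes "finite I" "\<And>i. i \<in> I \<Longrightarrow> smooth_map A (f i)"
  shows "smooth_map A (\<lambda>x. \<Sum>i\<in>I. f i x)"
  using assms
proof (induction I rule: finite_induct)
  case empty
  then show ?case by (simp add: smooth_map_linear)
next
  case (insert i I)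
  then show ?case by (simp add: smooth_map_add)
qed

text \<open>
  A vector of functions is a sum of functions composed with the linear inclusions \<^const>\<open>axis\<close>.
\<close>

lemma smooth_map_vec:
  fixes f :: "'n::finite \<Rightarrow> 'a::euclidean_space \<Rightarrow> 'b::euclidean_space"
  assumes "\<And>m. smooth_map A (f m)"
  shows "smooth_map A (\<lambda>x. \<chi> m. f m x)"
proof -
  have "linear (axis m :: 'b \<Rightarrow> 'b^'n)" for m
    by (simp add: linear_iff vec_eq_iff axis_def)
  then have "bounded_linear (axis m :: 'b \<Rightarrow> 'b^'n)" for m
    by (simp add: linear_conv_bounded_linear)
  then have "smooth_map A (\<lambda>x. \<Sum>m\<in>UNIV. axis m (f m x))"
    by (intro smooth_map_sum finite smooth_map_linear_comp[OF _ assms])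
  moreover have "(\<Sum>m\<in>UNIV. axis m (f m x)) = (\<chi> m. f m x)" for x
    by (simp add: vec_eq_iff axis_def if_distrib[of "\<lambda>f. f _"] cong: if_cong)
  ultimately show ?thesis by simp
qed

lemma smooth_map_imp_continuous_on:
  assumes "smooth_map A f"
  shows "continuous_on A f"
  unfolding continuous_on_eq_continuous_within
proof
  fix x assume x: "x \<in> A"
  obtain U F where U: "open U" "x \<in> U" "\<forall>k. C_on k U F" "\<forall>y\<in>A \<inter> U. F y = f y"
    using assms[unfolded smooth_map_def, THEN bspec, OF x] by (elim exE conjE) (rule that)
  have "continuous (at x within A) F"
    using U(3)[rule_format, of 0] U(1,2) by (simp add: continuous_on_eq_continuous_at continuous_at_imp_continuous_at_within)
  moreover have "\<forall>\<^sub>F y in at x within A. F y = f y"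
    using U by (auto simp: eventually_at_topological)
  ultimately show "continuous (at x within A) f"
    using U x by (auto simp: continuous_within elim: Lim_transform_eventually)
qed

lemma smooth_map_const: "smooth_map A (\<lambda>x. c)"
  unfolding smooth_map_def
  by (intro ballI exI[of _ UNIV] exI[of _ "\<lambda>x. c"]) (simp add: C_on_const)

lemma smooth_map_fst: "smooth_map A fst" and smooth_map_snd: "smooth_map A snd"
  by (simp_all add: smooth_map_linear bounded_linear_fst bounded_linear_snd)

lemma smooth_map_compose_fst:
  assumes "smooth_map \<Sigma> \<nu>" "\<And>z. z \<in> A \<Longrightarrow> fst z \<in> \<Sigma>"
  shows "smooth_map A (\<lambda>z. \<nu> (fst z))"
  using smooth_map_compose_linear[OF bounded_linear_fst assms(1)] assms(2) by blast

lemmas smooth_map_qmult = smooth_map_bilinear [OF qmult.bounded_bilinear_axioms]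
lemmas smooth_map_qcnj = smooth_map_linear_comp [OF bounded_linear_qcnj]

section \<open>Tangent spaces and the trivialization of the tangent bundle\<close>

text \<open>
  Velocities of the images under a chart of straight lines in its domain.
\<close>

lemma range_derivative_subset_tangent_space:
  fixes X :: "real^3 \<Rightarrow> quat"
  assumes "open W" "smooth_map W X" "u \<in> W" "X ` W \<subseteq> \<Sigma>"
  shows "X differentiable (at u)" "range (frechet_derivative X (at u)) \<subseteq> tangent_space \<Sigma> (X u)"
proof -
  obtain U F where U: "open U" "u \<in> U" "\<forall>k. C_on k U F" "\<forall>y\<in>W \<inter> U. F y = X y"
    using assms(2)[unfolded smooth_map_def, THEN bspec, OF assms(3)] by (elim exE conjE) (rule that)
  have "F differentiable (at u)"
    using U(2) U(3)[rule_format, of 1] by simp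
  then have "(F has_derivative frechet_derivative F (at u)) (at u)"
    by (simp add: frechet_derivative_works)
  from has_derivative_transform_within_open[OF this, of "U \<inter> W" X]
  have "(X has_derivative frechet_derivative F (at u)) (at u)"
    using U assms by auto
  then show "X differentiable (at u)"
    by (auto simp: differentiable_def)
  then have D: "(X has_derivative frechet_derivative X (at u)) (at u)"
    by (simp add: frechet_derivative_works)
  show "range (frechet_derivative X (at u)) \<subseteq> tangent_space \<Sigma> (X u)"
  proof
    fix v assume "v \<in> range (frechet_derivative X (at u))"
    then obtain w where v: "v = frechet_derivative X (at u) w" by auto
    \<comment> \<open>The velocity at \<open>0\<close> of this curve is \<open>v\<close> by the chain rule.\<close>
    let ?\<gamma> = "\<lambda>t::real. X (u + t *\<^sub>R w)"
    have bl: "bounded_linear (\<lambda>t::real. t *\<^sub>R w)"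
      by (rule bounded_linear_scaleR_left)
    then have "continuous_on UNIV (\<lambda>t::real. u + t *\<^sub>R w)"
      by (rule continuous_on_add[OF continuous_on_const linear_continuous_on])
    then have "open {t::real. u + t *\<^sub>R w \<in> W}"
      using assms(1) open_vimage[of W "\<lambda>t. u + t *\<^sub>R w"] by (simp add: vimage_def)
    moreover have "0 \<in> {t::real. u + t *\<^sub>R w \<in> W}"
      using assms(3) by simp
    ultimately obtain \<epsilon> where \<epsilon>: "\<epsilon> > 0" "ball 0 \<epsilon> \<subseteq> {t::real. u + t *\<^sub>R w \<in> W}"
      by (metis open_contains_ball)
    then have in_W: "u + t *\<^sub>R w \<in> W" if "t \<in> {-\<epsilon><..<\<epsilon>}" for t
      using that by (auto simp: subset_iff dist_real_def)
    have "smooth_map {-\<epsilon><..<\<epsilon>} ?\<gamma>"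
      by (rule smooth_map_compose_affine[OF bl assms(2) in_W])
    moreover have "?\<gamma> ` {-\<epsilon><..<\<epsilon>} \<subseteq> \<Sigma>"
      using in_W assms(4) by blast
    moreover have "(?\<gamma> has_vector_derivative v) (at 0)"
    proof -
      have "((\<lambda>t::real. u + t *\<^sub>R w) has_derivative (\<lambda>t. t *\<^sub>R w)) (at 0)"
        by (auto intro!: derivative_eq_intros)
      moreover have "(X has_derivative frechet_derivative X (at u)) (at (u + 0 *\<^sub>R w))"
        using D by simp
      ultimately have "(?\<gamma> has_derivative (\<lambda>t. frechet_derivative X (at u) (t *\<^sub>R w))) (at 0)"
        by (rule has_derivative_compose)
      then show ?thesis
        using linear_scale[OF has_derivative_linear[OF D]] by (simp add: has_vector_derivative_def v)
    qed
    ultimately show "v \<in> tangent_space \<Sigma> (X u)"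
      using \<epsilon>(1) unfolding tangent_space_def by (auto intro!: exI[of _ ?\<gamma>] exI[of _ \<epsilon>])
  qed
qed

text \<open>
  Since the tangent vectors are orthogonal to \<open>\<nu> p\<close> by hypothesis, only one inclusion needs work, and
  there the three-dimensional range of the derivative of a chart leaves no room. In particular the
  velocities of curves form a subspace.
\<close>

lemma tangent_space_eq_hyperplane:
  assumes "oriented_hypersurface \<Sigma> \<nu>" "p \<in> \<Sigma>"
  shows "tangent_space \<Sigma> p = {v. \<nu> p \<bullet> v = 0}"
proof
  have \<nu>: "norm (\<nu> p) = 1" "\<And>v. v \<in> tangent_space \<Sigma> p \<Longrightarrow> \<nu> p \<bullet> v = 0"
    using assms by (auto simp: oriented_hypersurface_def)
  then show sub: "tangent_space \<Sigma> p \<subseteq> {v. \<nu> p \<bullet> v = 0}"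
    by auto
  obtain W :: "(real^3) set" and V X Y where
    W: "open W" "p \<in> V" "openin (top_of_set \<Sigma>) V" "smooth_map W X" "homeomorphism W V X Y"
       "\<And>u. u \<in> W \<Longrightarrow> inj (frechet_derivative X (at u))"
    using assms unfolding oriented_hypersurface_def regular_hypersurface_def by metis
  define D where "D = frechet_derivative X (at (Y p))"
  have u: "Y p \<in> W" "X (Y p) = p" "X ` W \<subseteq> \<Sigma>"
    using W(2,5) openin_imp_subset[OF W(3)] by (auto simp: homeomorphism_def)
  have D: "range D \<subseteq> tangent_space \<Sigma> p" "linear D"
    using range_derivative_subset_tangent_space[OF W(1,4) u(1,3)] u(2)
    by (auto simp: D_def frechet_derivative_works has_derivative_linear)
  have "inj D"
    using W(6) u(1) by (simp add: D_def)
  then have "dim (range D) = 3"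
    using dim_image_eq[OF D(2), of UNIV] by simp
  moreover have "dim {v. \<nu> p \<bullet> v = 0} = 3"
    using \<nu>(1) dim_hyperplane[of "\<nu> p"] by fastforce
  moreover have "subspace (range D)"
    using D(2) linear_subspace_image subspace_UNIV by blast
  ultimately have "range D = {v. \<nu> p \<bullet> v = 0}"
    using D(1) sub by (intro subspace_dim_equal) (auto simp: subspace_hyperplane)
  with D(1) show "{v. \<nu> p \<bullet> v = 0} \<subseteq> tangent_space \<Sigma> p"
    by simp
qed

text \<open>
  \<open>qRe (qcnj n \<cdot>\<^sub>H v) = n \<bullet> v\<close> turns orthogonality to the normal into being imaginary.
\<close>

lemma tangent_isometry:
  assumes or: "oriented_hypersurface \<Sigma> \<nu>" and p: "p \<in> \<Sigma>"
  shows "isometric_isomorphism (tangent_space \<Sigma> p) ImH (\<lambda>v. qcnj (\<nu> p) \<cdot>\<^sub>H v)"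
proof -
  have n: "norm (\<nu> p) = 1"
    using assms by (simp add: oriented_hypersurface_def)
  note T = tangent_space_eq_hyperplane[OF or p]
  have "bij_betw (\<lambda>v. qcnj (\<nu> p) \<cdot>\<^sub>H v) (tangent_space \<Sigma> p) ImH"
    by (rule bij_betw_byWitness[where f' = "\<lambda>w. \<nu> p \<cdot>\<^sub>H w"])
       (auto simp: T ImH_def qRe_qcnj_qmult unit_qmult_cancel n qmult_adjoint(1) [of "\<nu> p", symmetric]
         simp flip: qRe_qcnj_qmult)
  then show ?thesis
    unfolding isometric_isomorphism_def
    using n inner_unit_qmult(1)[of "qcnj (\<nu> p)"]
    by (simp add: T subspace_hyperplane subspace_ImH bounded_linear.linear[OF qmult.bounded_linear_right])
qed

lemma trivialization_by_normal:
  assumes or: "oriented_hypersurface \<Sigma> \<nu>"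
  shows "global_trivialization \<Sigma> ImH (\<lambda>p v. qcnj (\<nu> p) \<cdot>\<^sub>H v)"
proof -
  have iso: "isometric_isomorphism (tangent_space \<Sigma> p) ImH (\<lambda>v. qcnj (\<nu> p) \<cdot>\<^sub>H v)" if "p \<in> \<Sigma>" for p
    using tangent_isometry[OF or that] .
  have n: "norm (\<nu> p) = 1" if "p \<in> \<Sigma>" for p
    using or that by (simp add: oriented_hypersurface_def)
  have smooth: "smooth_map \<Sigma> \<nu>"
    using or by (simp add: oriented_hypersurface_def)
  let ?f = "\<lambda>(p, v). (p, qcnj (\<nu> p) \<cdot>\<^sub>H v)" and ?g = "\<lambda>(p, w). (p, \<nu> p \<cdot>\<^sub>H w)"
  have "smooth_map (tangent_bundle \<Sigma>) (\<lambda>z. (fst z, qcnj (\<nu> (fst z)) \<cdot>\<^sub>H snd z))"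
    by (intro smooth_map_Pair smooth_map_fst smooth_map_snd smooth_map_qmult smooth_map_qcnj
        smooth_map_compose_fst[OF smooth]) (auto simp: tangent_bundle_def)
  moreover have "smooth_map (\<Sigma> \<times> ImH) (\<lambda>z. (fst z, \<nu> (fst z) \<cdot>\<^sub>H snd z))"
    by (intro smooth_map_Pair smooth_map_fst smooth_map_snd smooth_map_qmult
        smooth_map_compose_fst[OF smooth]) auto
  moreover have im: "qcnj (\<nu> p) \<cdot>\<^sub>H v \<in> ImH" if "p \<in> \<Sigma>" "v \<in> tangent_space \<Sigma> p" for p v
    using iso[OF that(1)] that(2) by (auto simp: isometric_isomorphism_def bij_betw_def)
  moreover have tan: "\<nu> p \<cdot>\<^sub>H w \<in> tangent_space \<Sigma> p" if p: "p \<in> \<Sigma>" and w: "w \<in> ImH" for p w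
  proof -
    have "ImH = (\<lambda>v. qcnj (\<nu> p) \<cdot>\<^sub>H v) ` tangent_space \<Sigma> p"
      using iso[OF p] by (simp add: isometric_isomorphism_def bij_betw_def)
    then obtain v where "v \<in> tangent_space \<Sigma> p" "w = qcnj (\<nu> p) \<cdot>\<^sub>H v"
      using w by blast
    then show ?thesis
      using unit_qmult_cancel(2)[OF n[OF p]] by simp
  qed
  moreover have "?f ` tangent_bundle \<Sigma> = \<Sigma> \<times> ImH"
  proof
    show "?f ` tangent_bundle \<Sigma> \<subseteq> \<Sigma> \<times> ImH"
      using im by (auto simp: tangent_bundle_def)
    show "\<Sigma> \<times> ImH \<subseteq> ?f ` tangent_bundle \<Sigma>"
    proof clarify
      fix p w assume "p \<in> \<Sigma>" "w \<in> ImH"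
      then show "(p, w) \<in> ?f ` tangent_bundle \<Sigma>"
        using tan n unit_qmult_cancel(1) by (intro image_eqI[of _ _ "(p, \<nu> p \<cdot>\<^sub>H w)"]) (auto simp: tangent_bundle_def)
    qed
  qed
  moreover have "?g ` (\<Sigma> \<times> ImH) = tangent_bundle \<Sigma>"
  proof
    show "?g ` (\<Sigma> \<times> ImH) \<subseteq> tangent_bundle \<Sigma>"
      using tan by (auto simp: tangent_bundle_def)
    show "tangent_bundle \<Sigma> \<subseteq> ?g ` (\<Sigma> \<times> ImH)"
    proof
      fix z assume "z \<in> tangent_bundle \<Sigma>"
      then obtain p v where "z = (p, v)" "p \<in> \<Sigma>" "v \<in> tangent_space \<Sigma> p"
        by (auto simp: tangent_bundle_def)
      then show "z \<in> ?g ` (\<Sigma> \<times> ImH)"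
        using im n unit_qmult_cancel(2) by (intro image_eqI[of _ _ "(p, qcnj (\<nu> p) \<cdot>\<^sub>H v)"]) auto
    qed
  qed
  ultimately have "diffeomorphism (tangent_bundle \<Sigma>) (\<Sigma> \<times> ImH) ?f ?g"
    unfolding diffeomorphism_def
    by (auto simp: case_prod_unfold tangent_bundle_def n unit_qmult_cancel)
  then show ?thesis
    unfolding global_trivialization_def using iso subspace_ImH by (auto simp: isometric_isomorphism_def)
qed

section \<open>The universal property of the Clifford algebra\<close>

text \<open>
  The ideal may be smaller than the kernel. For the action on the quaternions it is: the Clifford algebra
  of a three-dimensional tangent space is the sum of two copies of the quaternions, and one of them
  acts by zero.
\<close>

lemma ring_hom_factor:
  assumes "ring_hom_ring R S h" "ideal I R" "I \<subseteq> a_kernel R S h"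
  shows "\<exists>k \<in> ring_hom (R Quot I) S. \<forall>x\<in>carrier R. k (I +>\<^bsub>R\<^esub> x) = h x"
proof -
  interpret h: ring_hom_ring R S h by fact
  interpret I: ideal I R by fact
  define k where "k A = the_elem (h ` A)" for A
  have k: "k (I +>\<^bsub>R\<^esub> x) = h x" if x: "x \<in> carrier R" for x
  proof -
    have "h (i \<oplus>\<^bsub>R\<^esub> x) = h x" if i: "i \<in> I" for i
    proof -
      have "h i = \<zero>\<^bsub>S\<^esub>"
        using i assms(3) h.kernel_zero by blast
      then have "h (i \<oplus>\<^bsub>R\<^esub> x) = \<zero>\<^bsub>S\<^esub> \<oplus>\<^bsub>S\<^esub> h x"
        using h.hom_add[OF I.a_Hcarr[OF i] x] by (simp only:)
      then show ?thesis
        using h.S.l_zero[OF h.hom_closed[OF x]] by (simp only:)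
    qed
    then have "h ` (I +>\<^bsub>R\<^esub> x) \<subseteq> {h x}"
      unfolding a_r_coset_def' by blast
    moreover have "h x \<in> h ` (I +>\<^bsub>R\<^esub> x)"
      by (rule imageI[OF I.a_rcos_self[OF x]])
    ultimately have "h ` (I +>\<^bsub>R\<^esub> x) = {h x}"
      by blast
    then show ?thesis by (simp only: k_def the_elem_eq)
  qed
  have carrier: "\<exists>x\<in>carrier R. A = I +>\<^bsub>R\<^esub> x" if "A \<in> carrier (R Quot I)" for A
    using that unfolding FactRing_def A_RCOSETS_def' by simp
  have "k \<in> ring_hom (R Quot I) S"
  proof (rule ring_hom_memI)
    fix A B assume "A \<in> carrier (R Quot I)" "B \<in> carrier (R Quot I)"
    then obtain x y where x: "x \<in> carrier R" "A = I +>\<^bsub>R\<^esub> x" and y: "y \<in> carrier R" "B = I +>\<^bsub>R\<^esub> y"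
      using carrier by blast
    have "k A = h x" "k B = h y"
      using k[OF x(1)] k[OF y(1)] by (simp_all only: x y)
    then show "k A \<in> carrier S"
      using h.hom_closed[OF x(1)] by (simp only:)
    have "A \<otimes>\<^bsub>R Quot I\<^esub> B = I +>\<^bsub>R\<^esub> (x \<otimes>\<^bsub>R\<^esub> y)"
      using I.rcoset_mult_add[OF x(1) y(1)] by (simp only: FactRing_def monoid.simps x y)
    then show "k (A \<otimes>\<^bsub>R Quot I\<^esub> B) = k A \<otimes>\<^bsub>S\<^esub> k B"
      using k[OF h.R.m_closed[OF x(1) y(1)]] h.hom_mult[OF x(1) y(1)]
      by (simp only: \<open>k A = h x\<close> \<open>k B = h y\<close>)
    have "A \<oplus>\<^bsub>R Quot I\<^esub> B = I +>\<^bsub>R\<^esub> (x \<oplus>\<^bsub>R\<^esub> y)"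
      using I.a_rcos_sum[OF x(1) y(1)] by (simp only: FactRing_def ring.simps x y)
    then show "k (A \<oplus>\<^bsub>R Quot I\<^esub> B) = k A \<oplus>\<^bsub>S\<^esub> k B"
      using k[OF h.R.a_closed[OF x(1) y(1)]] h.hom_add[OF x(1) y(1)]
      by (simp only: \<open>k A = h x\<close> \<open>k B = h y\<close>)
  next
    show "k \<one>\<^bsub>R Quot I\<^esub> = \<one>\<^bsub>S\<^esub>"
      using k[OF h.R.one_closed] h.hom_one by (simp only: FactRing_def monoid.simps)
  qed
  with k show ?thesis
    by (intro bexI[of _ k] ballI)
qed

text \<open>
  The carrier and the product of \<^const>\<open>free_algebra\<close>, named so that they can be handled by simple
  rewriting.
\<close>

definition free_mult :: "('a list \<Rightarrow> real) \<Rightarrow> ('a list \<Rightarrow> real) \<Rightarrow> 'a list \<Rightarrow> real" where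
  "free_mult x y w = (\<Sum>n\<le>length w. x (take n w) * y (drop n w))"

definition fin_comb :: "'a set \<Rightarrow> ('a list \<Rightarrow> real) set" where
  "fin_comb V = {x. finite {w. x w \<noteq> 0} \<and> (\<forall>w. x w \<noteq> 0 \<longrightarrow> set w \<subseteq> V)}"

lemma free_algebra_simps [simp]:
  "carrier (free_algebra V) = fin_comb V"
  "x \<otimes>\<^bsub>free_algebra V\<^esub> y = free_mult x y"
  "\<one>\<^bsub>free_algebra V\<^esub> = monomial 1 []"
  "\<zero>\<^bsub>free_algebra V\<^esub> = (\<lambda>w. 0)"
  "x \<oplus>\<^bsub>free_algebra V\<^esub> y = (\<lambda>w. x w + y w)"
  by (simp_all add: free_algebra_def fin_comb_def free_mult_def monomial_def fun_eq_iff)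

lemma free_mult_support: "{w. free_mult x y w \<noteq> 0} \<subseteq> (\<lambda>(u, v). u @ v) ` ({w. x w \<noteq> 0} \<times> {w. y w \<noteq> 0})"
proof
  fix w assume "w \<in> {w. free_mult x y w \<noteq> 0}"
  then obtain n where "x (take n w) * y (drop n w) \<noteq> 0"
    unfolding free_mult_def by (metis (mono_tags, lifting) mem_Collect_eq sum.neutral)
  then show "w \<in> (\<lambda>(u, v). u @ v) ` ({w. x w \<noteq> 0} \<times> {w. y w \<noteq> 0})"
    by (intro image_eqI[of _ _ "(take n w, drop n w)"]) auto
qed

text \<open>
  Both sides sum over the ways of cutting \<open>w\<close> into three consecutive pieces: \<open>i\<close> is the length of the
  first piece and \<open>j\<close> the length of the second.
\<close>

lemma free_mult_assoc: "free_mult (free_mult x y) z = free_mult x (free_mult y z)"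
proof
  fix w :: "'a list"
  define G where "G i j = x (take i w) * y (take j (drop i w)) * z (drop (i + j) w)" for i j
  have "free_mult (free_mult x y) z w = (\<Sum>n\<le>length w. \<Sum>m\<le>n. G m (n - m))"
    by (auto simp: free_mult_def G_def sum_distrib_right min_absorb2 drop_take min_absorb1 intro!: sum.cong)
  also have "\<dots> = (\<Sum>(i, j)\<in>{(i, j). i + j \<le> length w}. G i j)"
    by (rule sum.triangle_reindex_eq [symmetric])
  also have "{(i, j). i + j \<le> length w} = Sigma {..length w} (\<lambda>i. {..length w - i})"
    by auto
  also have "(\<Sum>(i, j)\<in>Sigma {..length w} (\<lambda>i. {..length w - i}). G i j) =
             (\<Sum>i\<le>length w. \<Sum>j\<le>length w - i. G i j)"
    by (simp add: sum.Sigma)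
  also have "\<dots> = free_mult x (free_mult y z) w"
    by (auto simp: free_mult_def G_def sum_distrib_left mult.assoc add.commute intro!: sum.cong)
  finally show "free_mult (free_mult x y) z w = free_mult x (free_mult y z) w" .
qed

lemma monomial_in_fin_comb: "set u \<subseteq> V \<Longrightarrow> monomial r u \<in> fin_comb V"
  by (auto simp: fin_comb_def monomial_def)

lemma fin_comb_add: "x \<in> fin_comb V \<Longrightarrow> y \<in> fin_comb V \<Longrightarrow> (\<lambda>w. x w + y w) \<in> fin_comb V"
proof -
  assume "x \<in> fin_comb V" "y \<in> fin_comb V"
  moreover have "{w. x w + y w \<noteq> 0} \<subseteq> {w. x w \<noteq> 0} \<union> {w. y w \<noteq> 0}"
    by auto
  ultimately show ?thesis
    unfolding fin_comb_def by (blast intro: finite_subset)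
qed

lemma fin_comb_zero: "(\<lambda>w. 0) \<in> fin_comb V"
  by (simp add: fin_comb_def)

lemma fin_comb_minus: "x \<in> fin_comb V \<Longrightarrow> (\<lambda>w. - x w) \<in> fin_comb V"
  by (simp add: fin_comb_def)

lemma fin_comb_diff: "x \<in> fin_comb V \<Longrightarrow> y \<in> fin_comb V \<Longrightarrow> (\<lambda>w. x w - y w) \<in> fin_comb V"
  using fin_comb_add[OF _ fin_comb_minus, of x V y] by simp

lemma fin_comb_mult:
  assumes "x \<in> fin_comb V" "y \<in> fin_comb V"
  shows "free_mult x y \<in> fin_comb V"
proof -
  have "finite {w. free_mult x y w \<noteq> 0}"
    by (rule finite_subset[OF free_mult_support]) (use assms in \<open>simp add: fin_comb_def\<close>)
  moreover have "set w \<subseteq> V" if "free_mult x y w \<noteq> 0" for w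
  proof -
    obtain u v where "w = u @ v" "x u \<noteq> 0" "y v \<noteq> 0"
      using free_mult_support[of x y] \<open>free_mult x y w \<noteq> 0\<close> by auto
    then show ?thesis
      using assms by (simp add: fin_comb_def)
  qed
  ultimately show ?thesis by (simp add: fin_comb_def)
qed

lemma free_mult_one: "free_mult (monomial 1 []) x = x" "free_mult x (monomial 1 []) = x"
proof -
  have 1: "monomial 1 [] (take n w) * x (drop n w) = (if n = 0 then x w else 0)"
    if "n \<le> length w" for w and n
    using that by (auto simp: monomial_def)
  have 2: "x (take n w) * monomial 1 [] (drop n w) = (if n = length w then x w else 0)"
    if "n \<le> length w" for w and n
    using that by (auto simp: monomial_def)
  show "free_mult (monomial 1 []) x = x" "free_mult x (monomial 1 []) = x"
    by (simp_all add: fun_eq_iff free_mult_def 1 2)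
qed

lemma ring_free_algebra: "ring (free_algebra V)"
proof (rule ringI)
  show "abelian_group (free_algebra V)"
  proof (rule abelian_groupI)
    fix x assume "x \<in> carrier (free_algebra V)"
    then show "\<exists>y\<in>carrier (free_algebra V). y \<oplus>\<^bsub>free_algebra V\<^esub> x = \<zero>\<^bsub>free_algebra V\<^esub>"
      by (intro bexI[of _ "\<lambda>w. - x w"]) (simp_all add: fin_comb_minus)
  qed (simp_all add: fin_comb_add fin_comb_zero ac_simps)
  show "Group.monoid (free_algebra V)"
    by (rule monoidI) (simp_all add: fin_comb_mult monomial_in_fin_comb free_mult_assoc free_mult_one)
qed (simp_all add: free_mult_def fun_eq_iff algebra_simps sum.distrib)

lemma End_H_iff: "f \<in> carrier (End_H act) \<longleftrightarrow> linear f \<and> (\<forall>x h. f (act x h) = act (f x) h)"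
  by (simp add: End_H_def)

lemma End_H_simps [simp]:
  "f \<otimes>\<^bsub>End_H act\<^esub> g = f \<circ> g" "\<one>\<^bsub>End_H act\<^esub> = id"
  "\<zero>\<^bsub>End_H act\<^esub> = (\<lambda>x. 0)" "f \<oplus>\<^bsub>End_H act\<^esub> g = (\<lambda>x. f x + g x)"
  by (simp_all add: End_H_def)

lemma ring_End_H:
  assumes "\<And>h. linear (\<lambda>x. act x h)"
  shows "ring (End_H act)"
proof (rule ringI)
  note lin = linear_add[OF assms] linear_0[OF assms] linear_neg[OF assms]
  show "abelian_group (End_H act)"
  proof (rule abelian_groupI)
    fix f assume "f \<in> carrier (End_H act)"
    then show "\<exists>g\<in>carrier (End_H act). g \<oplus>\<^bsub>End_H act\<^esub> f = \<zero>\<^bsub>End_H act\<^esub>"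
      by (intro bexI[of _ "\<lambda>x. - f x"]) (simp_all add: End_H_iff lin linear_compose_neg)
  next
    show "\<zero>\<^bsub>End_H act\<^esub> \<in> carrier (End_H act)"
      by (simp add: End_H_iff lin linear_zero)
  next
    fix f g assume "f \<in> carrier (End_H act)" "g \<in> carrier (End_H act)"
    then show "f \<oplus>\<^bsub>End_H act\<^esub> g \<in> carrier (End_H act)"
      by (simp add: End_H_iff lin linear_compose_add)
  qed (simp_all add: ac_simps)
  show "Group.monoid (End_H act)"
    by (rule monoidI) (simp_all add: End_H_iff linear_id linear_compose comp_assoc id_def [symmetric])
qed (simp_all add: End_H_iff fun_eq_iff linear_add)

definition free_rep :: "('a \<Rightarrow> 'w \<Rightarrow> 'w::real_vector) \<Rightarrow> ('a list \<Rightarrow> real) \<Rightarrow> 'w \<Rightarrow> 'w" where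
  "free_rep \<phi> x q = (\<Sum>w | x w \<noteq> 0. x w *\<^sub>R foldr \<phi> w q)"

lemma free_rep_superset:
  assumes "finite S" "{w. x w \<noteq> 0} \<subseteq> S"
  shows "free_rep \<phi> x q = (\<Sum>w\<in>S. x w *\<^sub>R foldr \<phi> w q)"
  unfolding free_rep_def using assms by (intro sum.mono_neutral_left) auto

lemma free_rep_monomial: "free_rep \<phi> (monomial r u) q = r *\<^sub>R foldr \<phi> u q"
  by (subst free_rep_superset[of "{u}"]) (auto simp: monomial_def)

lemma free_rep_add:
  assumes "x \<in> fin_comb V" "y \<in> fin_comb V"
  shows "free_rep \<phi> (\<lambda>w. x w + y w) q = free_rep \<phi> x q + free_rep \<phi> y q"
proof -
  let ?S = "{w. x w \<noteq> 0} \<union> {w. y w \<noteq> 0}"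
  have "finite ?S"
    using assms by (simp add: fin_comb_def)
  then show ?thesis
    by (subst (1 2 3) free_rep_superset[of ?S]) (auto simp: scaleR_add_left sum.distrib)
qed

lemma free_rep_minus: "free_rep \<phi> (\<lambda>w. - x w) q = - free_rep \<phi> x q"
  by (simp add: free_rep_def sum_negf)

lemma free_rep_diff:
  assumes "x \<in> fin_comb V" "y \<in> fin_comb V"
  shows "free_rep \<phi> (\<lambda>w. x w - y w) q = free_rep \<phi> x q - free_rep \<phi> y q"
  using free_rep_add[OF assms(1) fin_comb_minus[OF assms(2)]] by (simp add: free_rep_minus)

lemma foldr_End_H:
  assumes "\<And>v. v \<in> V \<Longrightarrow> \<phi> v \<in> carrier (End_H act)" "set w \<subseteq> V"
  shows "foldr \<phi> w \<in> carrier (End_H act)"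
  using assms(2)
proof (induction w)
  case Nil
  show ?case by (simp add: End_H_iff linear_id [unfolded id_def])
next
  case (Cons v w)
  have "foldr \<phi> (v # w) = \<phi> v \<circ> foldr \<phi> w" by (simp add: fun_eq_iff)
  with Cons assms(1)[of v] show ?case
    by (simp add: End_H_iff linear_compose [unfolded o_def] o_def del: foldr.simps)
qed

text \<open>
  Over the pairs \<open>(w, n)\<close> of a word and a cutting point, and over the pairs \<open>(u, v)\<close> of words, the same
  terms occur. Cutting points for which a piece lies outside the support give zero terms, which is why the
  bijection is only required between the non-vanishing ones.
\<close>

lemma free_rep_mult:
  assumes \<phi>: "\<And>v. v \<in> V \<Longrightarrow> \<phi> v \<in> carrier (End_H act)"
    and x: "x \<in> fin_comb V" and y: "y \<in> fin_comb V"
  shows "free_rep \<phi> (free_mult x y) q = free_rep \<phi> x (free_rep \<phi> y q)"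
proof -
  define A where "A = {w. x w \<noteq> 0}"
  define B where "B = {w. y w \<noteq> 0}"
  define C where "C = (\<lambda>(u, v). u @ v) ` (A \<times> B)"
  define h where "h u v = (x u * y v) *\<^sub>R foldr \<phi> (u @ v) q" for u v
  let ?D = "Sigma C (\<lambda>w. {..length w})"
  have fin: "finite A" "finite B" "finite C"
    using x y by (auto simp: A_def B_def C_def fin_comb_def)
  have "{w. free_mult x y w \<noteq> 0} \<subseteq> C"
    using free_mult_support[of x y] by (simp add: A_def B_def C_def)
  then have "free_rep \<phi> (free_mult x y) q = (\<Sum>w\<in>C. \<Sum>n\<le>length w. h (take n w) (drop n w))"
    by (subst free_rep_superset[OF fin(3)]) (simp_all add: free_mult_def h_def scaleR_sum_left)
  also have "\<dots> = (\<Sum>(w, n)\<in>?D. h (take n w) (drop n w))"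
    using fin by (simp add: sum.Sigma)
  also have "\<dots> = (\<Sum>(u, v)\<in>A \<times> B. h u v)"
  proof (rule sum.reindex_bij_witness_not_neutral[where S' = "{(w, n) \<in> ?D. h (take n w) (drop n w) = 0}"
        and T' = "{(u, v) \<in> A \<times> B. h u v = 0}"
        and i = "\<lambda>(u, v). (u @ v, length u)" and j = "\<lambda>(w, n). (take n w, drop n w)"])
    show "finite {(w, n) \<in> ?D. h (take n w) (drop n w) = 0}"
      by (rule finite_subset[of _ ?D]) (use fin in auto)
    show "finite {(u, v) \<in> A \<times> B. h u v = 0}"
      by (rule finite_subset[of _ "A \<times> B"]) (use fin in auto)
    show "(case a of (w, n) \<Rightarrow> (take n w, drop n w)) \<in> A \<times> B - {(u, v) \<in> A \<times> B. h u v = 0}"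
      if "a \<in> ?D - {(w, n) \<in> ?D. h (take n w) (drop n w) = 0}" for a
      using that by (cases a) (simp add: h_def A_def B_def del: foldr_append)
    show "(case b of (u, v) \<Rightarrow> (u @ v, length u)) \<in> ?D - {(w, n) \<in> ?D. h (take n w) (drop n w) = 0}"
      if "b \<in> A \<times> B - {(u, v) \<in> A \<times> B. h u v = 0}" for b
      using that by (cases b) (simp add: C_def image_iff, blast)
  qed auto
  also have "\<dots> = (\<Sum>u\<in>A. \<Sum>v\<in>B. h u v)"
    by (simp add: sum.cartesian_product)
  also have "\<dots> = (\<Sum>u\<in>A. x u *\<^sub>R foldr \<phi> u (free_rep \<phi> y q))"
  proof (rule sum.cong[OF refl])
    fix u assume "u \<in> A"
    then have "linear (foldr \<phi> u)"
      using foldr_End_H[of V \<phi> act u] \<phi> x by (simp add: A_def fin_comb_def End_H_iff)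
    then show "(\<Sum>v\<in>B. h u v) = x u *\<^sub>R foldr \<phi> u (free_rep \<phi> y q)"
      by (simp add: free_rep_def B_def [symmetric] h_def linear_sum linear_scale scaleR_sum_right)
  qed
  finally show ?thesis
    by (simp add: free_rep_def[of _ x] A_def)
qed

lemma ring_hom_free_rep:
  assumes act: "\<And>h. linear (\<lambda>x. act x h)"
    and \<phi>: "\<And>v. v \<in> V \<Longrightarrow> \<phi> v \<in> carrier (End_H act)"
  shows "ring_hom_ring (free_algebra V) (End_H act) (free_rep \<phi>)"
proof (intro ring_hom_ringI2 ring_free_algebra ring_End_H act ring_hom_memI)
  fix x y assume x: "x \<in> carrier (free_algebra V)" and y: "y \<in> carrier (free_algebra V)"
  have w: "linear (foldr \<phi> w)" "foldr \<phi> w (act q h) = act (foldr \<phi> w q) h" if "x w \<noteq> 0" for w q h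
    using foldr_End_H[of V \<phi> act w] \<phi> x that by (auto simp: fin_comb_def End_H_iff)
  have "linear (free_rep \<phi> x)"
    unfolding free_rep_def by (intro linear_compose_sum ballI linear_compose_scale_right) (simp add: w)
  moreover have "free_rep \<phi> x (act q h) = act (free_rep \<phi> x q) h" for q h
    by (simp add: free_rep_def w linear_sum[OF act] linear_scale[OF act])
  ultimately show "free_rep \<phi> x \<in> carrier (End_H act)"
    by (simp add: End_H_iff)
  show "free_rep \<phi> (x \<otimes>\<^bsub>free_algebra V\<^esub> y) = free_rep \<phi> x \<otimes>\<^bsub>End_H act\<^esub> free_rep \<phi> y"
    using free_rep_mult[of V \<phi> act x y] \<phi> x y by (simp add: fun_eq_iff)
  show "free_rep \<phi> (x \<oplus>\<^bsub>free_algebra V\<^esub> y) = free_rep \<phi> x \<oplus>\<^bsub>End_H act\<^esub> free_rep \<phi> y"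
    using x y by (simp add: fun_eq_iff free_rep_add)
next
  show "free_rep \<phi> \<one>\<^bsub>free_algebra V\<^esub> = \<one>\<^bsub>End_H act\<^esub>"
    by (simp add: fun_eq_iff free_rep_monomial)
qed

text \<open>
  The universal property of the Clifford algebra, with values in right linear endomorphisms: a linear
  \<open>\<phi>\<close> that satisfies the Clifford relations extends to the free algebra, and it kills the generators of the
  Clifford ideal.
\<close>

lemma clifford_algebra_lift:
  assumes V: "subspace V" and act: "\<And>h. linear (\<lambda>x. act x h)"
    and \<phi>: "\<And>v. v \<in> V \<Longrightarrow> \<phi> v \<in> carrier (End_H act)"
    and add: "\<And>v w q. v \<in> V \<Longrightarrow> w \<in> V \<Longrightarrow> \<phi> (v + w) q = \<phi> v q + \<phi> w q"
    and scale: "\<And>r v q. v \<in> V \<Longrightarrow> \<phi> (r *\<^sub>R v) q = r *\<^sub>R \<phi> v q"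
    and clifford: "\<And>v w q. v \<in> V \<Longrightarrow> w \<in> V \<Longrightarrow>
      \<phi> v (\<phi> w q) + \<phi> w (\<phi> v q) = (- 2 * g v w) *\<^sub>R q"
  shows "\<exists>\<rho> \<in> ring_hom (clifford_algebra V g) (End_H act).
    (\<forall>r. \<rho> (clifford_scalar V g r) = (\<lambda>x. r *\<^sub>R x)) \<and> (\<forall>v\<in>V. \<rho> (clifford_vec V g v) = \<phi> v)"
proof -
  interpret h: ring_hom_ring "free_algebra V" "End_H act" "free_rep \<phi>"
    using act \<phi> by (rule ring_hom_free_rep)
  let ?K = "a_kernel (free_algebra V) (End_H act) (free_rep \<phi>)"
  note carr = monomial_in_fin_comb fin_comb_add fin_comb_diff
  have "x \<in> ?K" if rel: "x \<in> clifford_relations V g" for x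
  proof -
    consider (add) v w where "v \<in> V" "w \<in> V"
        "x = (\<lambda>u. monomial 1 [v + w] u - monomial 1 [v] u - monomial 1 [w] u)"
      | (scale) r v where "v \<in> V" "x = (\<lambda>u. monomial 1 [r *\<^sub>R v] u - monomial r [v] u)"
      | (mult) v w where "v \<in> V" "w \<in> V"
        "x = (\<lambda>u. monomial 1 [v, w] u + monomial 1 [w, v] u + monomial (2 * g v w) [] u)"
      using rel unfolding clifford_relations_def by blast
    then have "x \<in> fin_comb V \<and> (\<forall>q. free_rep \<phi> x q = 0)"
    proof cases
      case add
      with subspace_add[OF V] show ?thesis
        by (simp add: carr free_rep_diff[where V = V] free_rep_monomial assms(4))
    next
      case scale
      with subspace_scale[OF V] show ?thesis
        by (simp add: carr free_rep_diff[where V = V] free_rep_monomial assms(5))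
    next
      case mult
      then show ?thesis
        by (simp add: carr free_rep_add[where V = V] free_rep_monomial clifford)
    qed
    then have "x \<in> fin_comb V" "free_rep \<phi> x = (\<lambda>q. 0)"
      by blast+
    then show ?thesis
      unfolding a_kernel_def' by simp
  qed
  then have sub: "clifford_relations V g \<subseteq> ?K" by blast
  then have "clifford_relations V g \<subseteq> carrier (free_algebra V)"
    unfolding a_kernel_def' by blast
  then have "ideal (clifford_ideal V g) (free_algebra V)"
    unfolding clifford_ideal_def by (rule h.R.genideal_ideal)
  moreover have "clifford_ideal V g \<subseteq> ?K"
    unfolding clifford_ideal_def by (rule h.R.genideal_minimal[OF h.kernel_is_ideal sub])
  ultimately obtain \<rho> where \<rho>: "\<rho> \<in> ring_hom (clifford_algebra V g) (End_H act)"
    "\<And>x. x \<in> fin_comb V \<Longrightarrow> \<rho> (clifford_ideal V g +>\<^bsub>free_algebra V\<^esub> x) = free_rep \<phi> x"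
    using ring_hom_factor[OF h.ring_hom_ring_axioms] unfolding clifford_algebra_def free_algebra_simps
    by blast
  then show ?thesis
    by (intro bexI[of _ \<rho>])
       (simp_all add: clifford_scalar_def clifford_vec_def monomial_in_fin_comb free_rep_monomial fun_eq_iff)
qed

section \<open>The Clifford bimodule\<close>

lemma right_H_module_qmult: "right_H_module (\<cdot>\<^sub>H)"
  by (simp add: right_H_module_def bilinear_qmult qmult_assoc)

lemma left_mult_End_H: "(\<lambda>q. a \<cdot>\<^sub>H q) \<in> carrier (End_H (\<cdot>\<^sub>H))"
  by (simp add: End_H_iff bounded_linear.linear[OF qmult.bounded_linear_right] qmult_assoc)

text \<open>
  A nonzero \<open>x\<close> is invertible, so the right ideal that it generates contains every \<open>y\<close>.
\<close>

lemma right_ideal_trivial: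
  assumes "\<And>x h. x \<in> S \<Longrightarrow> x \<cdot>\<^sub>H h \<in> S" "subspace S"
  shows "S = {0} \<or> S = UNIV"
proof (rule disjCI)
  assume "S \<noteq> UNIV"
  have "x = 0" if x: "x \<in> S" for x
  proof (rule ccontr)
    assume "x \<noteq> 0"
    then have "x \<cdot>\<^sub>H ((1 / (x \<bullet> x)) *\<^sub>R (qcnj x \<cdot>\<^sub>H y)) = y" for y
      by (simp add: qmult.scaleR_right qmult_assoc [symmetric] qcnj_qmult_self qmult.scaleR_left)
    then have "y \<in> S" for y
      using assms(1)[OF x] by metis
    with \<open>S \<noteq> UNIV\<close> show False by blast
  qed
  then show "S = {0}"
    using subspace_0[OF assms(2)] by blast
qed

lemma inner_product_qmetric: "inner_product qmetric"
  using bilinear_conv_bounded_bilinear[of "(\<bullet>) :: quat \<Rightarrow> _"] bounded_bilinear_inner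
  by (simp add: inner_product_def qmetric_eq_inner inner_commute)

lemma skew_adjoint_ImH_mult:
  assumes "a \<in> ImH"
  shows "skew_adjoint qmetric (\<lambda>q. a \<cdot>\<^sub>H q)" "skew_adjoint qmetric (\<lambda>q. q \<cdot>\<^sub>H a)"
proof -
  have "qcnj a = - a"
    using assms by (simp add: ImH_iff)
  then show "skew_adjoint qmetric (\<lambda>q. a \<cdot>\<^sub>H q)" "skew_adjoint qmetric (\<lambda>q. q \<cdot>\<^sub>H a)"
    by (simp_all add: skew_adjoint_def qmetric_eq_inner qmult_adjoint(1)[of a] qmult_adjoint(2)[of _ a]
        qmult.minus_left qmult.minus_right)
qed

text \<open>
  The Clifford relation for \<open>\<phi>\<close> is \<open>ImH_anticommute\<close> for the imaginary quaternions \<open>qcnj (\<nu> p) \<cdot>\<^sub>H v\<close>,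
  together with the isometry property of \<open>v \<mapsto> qcnj (\<nu> p) \<cdot>\<^sub>H v\<close>.
\<close>

lemma clifford_action:
  assumes or: "oriented_hypersurface \<Sigma> \<nu>" and p: "p \<in> \<Sigma>"
  shows "\<exists>\<rho>. (\<forall>v\<in>tangent_space \<Sigma> p.
      \<rho> (clifford_vec (tangent_space \<Sigma> p) (\<bullet>) v) = (\<lambda>q. qcnj (\<nu> p) \<cdot>\<^sub>H v \<cdot>\<^sub>H q)) \<and>
    irreducible_clifford_bimodule (tangent_space \<Sigma> p) (\<bullet>) \<rho> (\<cdot>\<^sub>H)"
proof -
  let ?V = "tangent_space \<Sigma> p" and ?\<phi> = "\<lambda>v q. qcnj (\<nu> p) \<cdot>\<^sub>H v \<cdot>\<^sub>H q"
  have iso: "isometric_isomorphism ?V ImH (\<lambda>v. qcnj (\<nu> p) \<cdot>\<^sub>H v)"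
    using assms by (rule tangent_isometry)
  have clifford: "?\<phi> v (?\<phi> w q) + ?\<phi> w (?\<phi> v q) = (- 2 * (v \<bullet> w)) *\<^sub>R q" if "v \<in> ?V" "w \<in> ?V" for v w q
  proof -
    let ?a = "qcnj (\<nu> p) \<cdot>\<^sub>H v" and ?b = "qcnj (\<nu> p) \<cdot>\<^sub>H w"
    have "?a \<in> ImH" "?b \<in> ImH" "?a \<bullet> ?b = v \<bullet> w"
      using iso that by (auto simp: isometric_isomorphism_def bij_betw_def)
    then have "?a \<cdot>\<^sub>H ?b + ?b \<cdot>\<^sub>H ?a = (- 2 * (v \<bullet> w)) *\<^sub>R qone"
      by (metis ImH_anticommute)
    then have "(?a \<cdot>\<^sub>H ?b + ?b \<cdot>\<^sub>H ?a) \<cdot>\<^sub>H q = (- 2 * (v \<bullet> w)) *\<^sub>R q"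
      by (simp only: qmult.scaleR_left qone_qmult)
    then show ?thesis
      by (simp only: qmult.add_left qmult_assoc)
  qed
  have "subspace ?V"
    using iso by (simp add: isometric_isomorphism_def)
  then obtain \<rho> where \<rho>: "\<rho> \<in> ring_hom (clifford_algebra ?V (\<bullet>)) (End_H (\<cdot>\<^sub>H))"
    "\<And>r. \<rho> (clifford_scalar ?V (\<bullet>) r) = (\<lambda>x. r *\<^sub>R x)"
    "\<And>v. v \<in> ?V \<Longrightarrow> \<rho> (clifford_vec ?V (\<bullet>) v) = ?\<phi> v"
    using clifford_algebra_lift[where V = ?V and act = "(\<cdot>\<^sub>H)" and \<phi> = ?\<phi> and g = "(\<bullet>)",
        OF _ bounded_linear.linear[OF qmult.bounded_linear_left] left_mult_End_H _ _ clifford]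
    by (auto simp: qmult.add_left qmult.add_right qmult.scaleR_left qmult.scaleR_right)
  have "(UNIV :: quat set) \<noteq> {0}"
    using axis_eq_0_iff[of "1 :: 4" "1 :: real"] by auto
  then have "irreducible_clifford_bimodule ?V (\<bullet>) \<rho> (\<cdot>\<^sub>H)"
    unfolding irreducible_clifford_bimodule_def clifford_bimodule_def
    using right_H_module_qmult \<rho>(1,2) right_ideal_trivial by blast
  with \<rho>(3) show ?thesis by blast
qed

lemma smooth_clifford_multiplication:
  assumes "oriented_hypersurface \<Sigma> \<nu>"
  shows "smooth_map {(p, v, x). p \<in> \<Sigma> \<and> v \<in> tangent_space \<Sigma> p}
    (\<lambda>(p, v, x). qcnj (\<nu> p) \<cdot>\<^sub>H v \<cdot>\<^sub>H x)" (is "smooth_map ?A _")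
proof -
  have "smooth_map \<Sigma> \<nu>"
    using assms by (simp add: oriented_hypersurface_def)
  then have "smooth_map ?A (\<lambda>z. \<nu> (fst z))"
    by (rule smooth_map_compose_fst) auto
  then have "smooth_map ?A (\<lambda>z. qcnj (\<nu> (fst z)) \<cdot>\<^sub>H fst (snd z) \<cdot>\<^sub>H snd (snd z))"
    by (intro smooth_map_qmult smooth_map_qcnj smooth_map_linear_comp[OF bounded_linear_fst smooth_map_snd]
        smooth_map_linear_comp[OF bounded_linear_snd smooth_map_snd])
  then show ?thesis
    by (simp add: case_prod_unfold)
qed

section \<open>Rotated triads of imaginary quaternions\<close>

definition qunit :: "3 \<Rightarrow> quat" where "qunit m = im_embed (axis m 1)"

lemma qunit_simps [simp]:
  "qunit 1 = Quat 0 1 0 0" "qunit 2 = Quat 0 0 1 0" "qunit 3 = Quat 0 0 0 1"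
  by (simp_all add: qunit_def im_embed_def axis_def)

text \<open>
  Averaging over the quaternion group is the projection to the real line, up to a factor.
\<close>

lemma sum_conjugates: "x + (\<Sum>m\<in>UNIV. qunit m \<cdot>\<^sub>H x \<cdot>\<^sub>H qcnj (qunit m)) = (4 * qRe x) *\<^sub>R qone"
  by (simp add: sum_3) (simp add: quat_expand)

text \<open>
  For an orthonormal triad of imaginary quaternions the product of the first two is their cross product, so
  the last condition singles out the positive orientation.
\<close>

definition oriented_triad :: "quat^3 \<Rightarrow> bool" where
  "oriented_triad f \<longleftrightarrow> (\<forall>m. f $ m \<in> ImH) \<and> (\<forall>m n. f $ m \<bullet> f $ n = (if m = n then 1 else 0)) \<and>
     f $ 1 \<cdot>\<^sub>H f $ 2 = f $ 3"

definition rotated_triad :: "quat \<Rightarrow> quat^3" where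
  "rotated_triad g = (\<chi> m. g \<cdot>\<^sub>H qunit m \<cdot>\<^sub>H qcnj g)"

lemma qunit_triad:
  "qunit m \<in> ImH" "qunit m \<bullet> qunit n = (if m = n then 1 else 0)" "qunit 1 \<cdot>\<^sub>H qunit 2 = qunit 3"
proof -
  show "qunit m \<in> ImH"
    by (simp add: ImH_def qRe_def qunit_def im_embed_def)
  have "\<forall>m n. qunit m \<bullet> qunit n = (if m = n then 1 else 0)"
    by (simp add: forall_3 inner_vec_def sum_4)
  then show "qunit m \<bullet> qunit n = (if m = n then 1 else 0)" by blast
  show "qunit 1 \<cdot>\<^sub>H qunit 2 = qunit 3"
    by (simp add: quat_expand)
qed

lemma oriented_triad_rotated_triad:
  assumes g: "norm g = 1"
  shows "oriented_triad (rotated_triad g)"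
proof -
  have "g \<cdot>\<^sub>H x \<cdot>\<^sub>H qcnj g \<in> ImH" if "x \<in> ImH" for x
    using that by (simp add: ImH_iff qcnj_qmult qmult_assoc qmult.minus_left qmult.minus_right)
  moreover have "(g \<cdot>\<^sub>H x \<cdot>\<^sub>H qcnj g) \<bullet> (g \<cdot>\<^sub>H y \<cdot>\<^sub>H qcnj g) = x \<bullet> y" for x y
    using g by (simp add: inner_unit_qmult)
  moreover have "(g \<cdot>\<^sub>H x \<cdot>\<^sub>H qcnj g) \<cdot>\<^sub>H (g \<cdot>\<^sub>H y \<cdot>\<^sub>H qcnj g) = g \<cdot>\<^sub>H (x \<cdot>\<^sub>H y) \<cdot>\<^sub>H qcnj g" for x y
    using unit_qmult_cancel(1)[OF g] by (simp add: qmult_assoc)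
  ultimately show ?thesis
    by (simp add: oriented_triad_def rotated_triad_def qunit_triad del: qunit_simps)
qed

text \<open>
  Up to normalization this inverts \<^const>\<open>rotated_triad\<close>, and it is affine in the triad. The parameter
  \<open>a\<close> determines on which hemisphere the inversion is possible.
\<close>

definition triad_avg :: "quat^3 \<Rightarrow> quat \<Rightarrow> quat" where
  "triad_avg f a = a + (\<Sum>m\<in>UNIV. f $ m \<cdot>\<^sub>H a \<cdot>\<^sub>H qcnj (qunit m))"

text \<open>
  Writing \<open>a = g (qcnj g a)\<close> moves \<open>g\<close> to the front and leaves the average of \<open>qcnj g a\<close>, whose real part is
  \<open>g \<bullet> a\<close>.
\<close>

lemma triad_avg_rotated_triad:
  assumes g: "norm g = 1"
  shows "triad_avg (rotated_triad g) a = (4 * (g \<bullet> a)) *\<^sub>R g"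
proof -
  let ?x = "qcnj g \<cdot>\<^sub>H a"
  have "triad_avg (rotated_triad g) a =
        g \<cdot>\<^sub>H (?x + (\<Sum>m\<in>UNIV. qunit m \<cdot>\<^sub>H ?x \<cdot>\<^sub>H qcnj (qunit m)))"
    unfolding triad_avg_def rotated_triad_def
    by (simp add: qmult.add_right qmult.sum_right qmult_assoc unit_qmult_cancel g del: qunit_simps)
  then show ?thesis
    by (simp only: sum_conjugates qRe_qcnj_qmult qmult.scaleR_right qone_qmult)
qed

text \<open>
  If the averages of \<open>1, i, j, k\<close> vanished, then so would the sum of their components at \<open>1, i, j, k\<close>
  respectively. In that sum the contributions of the triad cancel and \<open>4\<close> remains.
\<close>

lemma ex_triad_avg_nonzero: "\<exists>a. triad_avg f a \<noteq> 0"
proof (rule ccontr)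
  assume "\<not> ?thesis"
  then have "triad_avg f qone = 0" "triad_avg f (qunit 1) = 0" "triad_avg f (qunit 2) = 0"
    "triad_avg f (qunit 3) = 0"
    by blast+
  then have "triad_avg f qone $ 1 = 0" "triad_avg f (qunit 1) $ 2 = 0" "triad_avg f (qunit 2) $ 3 = 0"
    "triad_avg f (qunit 3) $ 4 = 0"
    by (simp_all del: qunit_simps)
  then show False
    by (simp add: triad_avg_def sum_3 quat_expand)
qed

text \<open>
  An oriented triad has the multiplication table of \<open>i, j, k\<close>. Thus multiplying \<open>triad_avg f a\<close> by \<open>f $ m\<close>
  from the left and by \<open>qunit m\<close> from the right produces the same four terms in a different order.
\<close>

lemma triad_avg_intertwines:
  assumes f: "oriented_triad f"
  shows "f $ m \<cdot>\<^sub>H triad_avg f a = triad_avg f a \<cdot>\<^sub>H qunit m"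
proof -
  have im: "qcnj (f $ m) = - f $ m" for m
    using f by (simp add: oriented_triad_def ImH_iff)
  have sq: "f $ m \<cdot>\<^sub>H f $ m = - qone" for m
    using f ImH_qmult_self[of "f $ m"] by (simp add: oriented_triad_def)
  have t12: "f $ 1 \<cdot>\<^sub>H f $ 2 = f $ 3"
    using f by (simp add: oriented_triad_def)
  have t21: "f $ 2 \<cdot>\<^sub>H f $ 1 = - f $ 3"
    using arg_cong[OF t12, of qcnj] by (simp add: qcnj_qmult im qmult.minus_left qmult.minus_right)
  have t13: "f $ 1 \<cdot>\<^sub>H f $ 3 = - f $ 2"
    by (simp add: t12 [symmetric] qmult_assoc [symmetric] sq qmult.minus_left)
  have t31: "f $ 3 \<cdot>\<^sub>H f $ 1 = f $ 2"
    using arg_cong[OF t13, of qcnj] im[of 2]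
    by (simp add: qcnj_qmult im qmult.minus_left qmult.minus_right linear_neg[OF bounded_linear.linear[OF bounded_linear_qcnj]])
  have t32: "f $ 3 \<cdot>\<^sub>H f $ 2 = - f $ 1"
    by (simp add: t12 [symmetric] qmult_assoc sq qmult.minus_right)
  have t23: "f $ 2 \<cdot>\<^sub>H f $ 3 = f $ 1"
    using arg_cong[OF t32, of qcnj] im[of 1]
    by (simp add: qcnj_qmult im qmult.minus_left qmult.minus_right linear_neg[OF bounded_linear.linear[OF bounded_linear_qcnj]])
  have K: "triad_avg f a = a - f $ 1 \<cdot>\<^sub>H (a \<cdot>\<^sub>H qunit 1) - f $ 2 \<cdot>\<^sub>H (a \<cdot>\<^sub>H qunit 2) - f $ 3 \<cdot>\<^sub>H (a \<cdot>\<^sub>H qunit 3)"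
    using qunit_triad(1)
    by (simp add: triad_avg_def sum_3 ImH_iff qmult.minus_right qmult_assoc del: qunit_simps)
  have e: "qunit 1 \<cdot>\<^sub>H qunit 1 = - qone" "qunit 2 \<cdot>\<^sub>H qunit 2 = - qone" "qunit 3 \<cdot>\<^sub>H qunit 3 = - qone"
    "qunit 1 \<cdot>\<^sub>H qunit 2 = qunit 3" "qunit 2 \<cdot>\<^sub>H qunit 1 = - qunit 3"
    "qunit 2 \<cdot>\<^sub>H qunit 3 = qunit 1" "qunit 3 \<cdot>\<^sub>H qunit 2 = - qunit 1"
    "qunit 3 \<cdot>\<^sub>H qunit 1 = qunit 2" "qunit 1 \<cdot>\<^sub>H qunit 3 = - qunit 2"
    by (simp_all add: quat_expand)
  have ff: "f $ i \<cdot>\<^sub>H (f $ j \<cdot>\<^sub>H x) = (f $ i \<cdot>\<^sub>H f $ j) \<cdot>\<^sub>H x" for i j x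
    by (simp add: qmult_assoc)
  have "\<forall>m. f $ m \<cdot>\<^sub>H triad_avg f a = triad_avg f a \<cdot>\<^sub>H qunit m"
    unfolding forall_3 K
    by (simp add: qmult.diff_left qmult.diff_right ff sq t12 t21 t13 t31 t23 t32
        qmult.minus_left qmult.minus_right del: qunit_simps)
       (simp add: qmult_assoc e qmult.minus_left qmult.minus_right del: qunit_simps)
  then show ?thesis by blast
qed

lemma oriented_triad_imp_rotated:
  assumes f: "oriented_triad f"
  shows "\<exists>g. norm g = 1 \<and> f = rotated_triad g"
proof -
  obtain a where a: "triad_avg f a \<noteq> 0"
    using ex_triad_avg_nonzero by blast
  define g where "g = sgn (triad_avg f a)"
  have g: "norm g = 1"
    using a by (simp add: g_def norm_sgn)
  have "f $ m \<cdot>\<^sub>H g = g \<cdot>\<^sub>H qunit m" for m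
    by (simp add: g_def sgn_div_norm qmult.scaleR_left qmult.scaleR_right triad_avg_intertwines[OF f]
        del: qunit_simps)
  then have "f $ m = g \<cdot>\<^sub>H qunit m \<cdot>\<^sub>H qcnj g" for m
    using unit_qmult_cancel(3)[OF g, of "f $ m"] by simp
  then show ?thesis
    using g by (auto simp: rotated_triad_def vec_eq_iff)
qed

text \<open>
  The averages of \<open>h\<close> over the two triads are \<open>4 (g \<bullet> h) g\<close> and \<open>4 h\<close>.
\<close>

lemma rotated_triad_eq_iff:
  assumes "norm g = 1" "norm h = 1"
  shows "rotated_triad g = rotated_triad h \<longleftrightarrow> g = h \<or> g = - h"
proof
  assume eq: "rotated_triad g = rotated_triad h"
  have "4 *\<^sub>R h = (4 * (g \<bullet> h)) *\<^sub>R g"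
    using triad_avg_rotated_triad[OF assms(1), of h] triad_avg_rotated_triad[OF assms(2), of h] assms eq
    by (simp add: dot_square_norm)
  then have "h = (g \<bullet> h) *\<^sub>R g"
    by (simp only: scaleR_scaleR [symmetric] scaleR_cancel_left) simp
  moreover from this have "\<bar>g \<bullet> h\<bar> = 1"
    using assms by (metis mult.right_neutral norm_scaleR)
  ultimately show "g = h \<or> g = - h"
    by (metis abs_eq_iff' abs_1 scaleR_minus1_left scaleR_one minus_minus)
next
  assume "g = h \<or> g = - h"
  then show "rotated_triad g = rotated_triad h"
    using linear_neg[OF bounded_linear.linear[OF bounded_linear_qcnj]]
    by (auto simp: rotated_triad_def qmult.minus_left qmult.minus_right)
qed

lemma det_4:
  "det (A::'a::comm_ring_1^4^4) =
     A$1$1 * (A$2$2 * (A$3$3 * A$4$4 - A$3$4 * A$4$3) - A$2$3 * (A$3$2 * A$4$4 - A$3$4 * A$4$2)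
        + A$2$4 * (A$3$2 * A$4$3 - A$3$3 * A$4$2))
   - A$1$2 * (A$2$1 * (A$3$3 * A$4$4 - A$3$4 * A$4$3) - A$2$3 * (A$3$1 * A$4$4 - A$3$4 * A$4$1)
        + A$2$4 * (A$3$1 * A$4$3 - A$3$3 * A$4$1))
   + A$1$3 * (A$2$1 * (A$3$2 * A$4$4 - A$3$4 * A$4$2) - A$2$2 * (A$3$1 * A$4$4 - A$3$4 * A$4$1)
        + A$2$4 * (A$3$1 * A$4$2 - A$3$2 * A$4$1))
   - A$1$4 * (A$2$1 * (A$3$2 * A$4$3 - A$3$3 * A$4$2) - A$2$2 * (A$3$1 * A$4$3 - A$3$3 * A$4$1)
        + A$2$3 * (A$3$1 * A$4$2 - A$3$2 * A$4$1))"
proof -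
  have f1234: "finite {2::4, 3, 4}" "1 \<notin> {2::4, 3, 4}"
    by auto
  have f234: "finite {3::4, 4}" "2 \<notin> {3::4, 4}"
    by auto
  have f34: "finite {4::4}" "3 \<notin> {4::4}"
    by auto
  show ?thesis
    unfolding det_def UNIV_4
    unfolding sum_over_permutations_insert[OF f1234]
    unfolding sum_over_permutations_insert[OF f234]
    unfolding sum_over_permutations_insert[OF f34]
    unfolding permutes_sing
    by (simp add: sign_swap_id permutation_swap_id permutation_compose sign_compose sign_id
        swap_id_eq algebra_simps)
qed

text \<open>
  The rows are the images of \<open>1, f $ 1, f $ 2, f $ 3\<close> under left multiplication by \<open>n\<close>, which has determinant
  \<open>(n \<bullet> n)\<^sup>2\<close>; the remaining determinant is the triple product of the imaginary parts.
\<close>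

lemma det_frame:
  assumes "\<And>m. f $ m \<in> ImH"
  shows "det ((\<chi> m. if m = 1 then n else if m = 2 then n \<cdot>\<^sub>H f $ 1 else if m = 3 then n \<cdot>\<^sub>H f $ 2
      else n \<cdot>\<^sub>H f $ 3) :: real^4^4) = (n \<bullet> n)\<^sup>2 * ((f $ 1 \<cdot>\<^sub>H f $ 2) \<bullet> f $ 3)"
proof -
  define N :: "real^4^4" where
    "N = (\<chi> m. if m = 1 then qone else if m = 2 then f $ 1 else if m = 3 then f $ 2 else f $ 3)"
  define T :: "real^4^4" where "T = (\<chi> i. n \<cdot>\<^sub>H axis i 1)"
  have re: "f $ m $ 1 = 0" for m
    using assms[of m] by (simp add: ImH_def qRe_def)
  have row: "n \<cdot>\<^sub>H x = x v* T" for x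
  proof -
    have "x v* T = (\<Sum>i\<in>UNIV. x $ i *\<^sub>R (n \<cdot>\<^sub>H axis i 1))"
      by (simp add: vec_eq_iff vector_matrix_mult_def T_def mult.commute)
    also have "\<dots> = n \<cdot>\<^sub>H (\<Sum>i\<in>UNIV. x $ i *\<^sub>R axis i 1)"
      by (simp add: qmult.sum_right qmult.scaleR_right)
    finally show ?thesis
      using basis_expansion[of x] by (simp add: scalar_mult_eq_scaleR)
  qed
  have "(\<chi> m. if m = 1 then n else if m = 2 then n \<cdot>\<^sub>H f $ 1 else if m = 3 then n \<cdot>\<^sub>H f $ 2
      else n \<cdot>\<^sub>H f $ 3) = N ** T"
  proof -
    have "(N ** T) $ m = N $ m v* T" for m
      by (simp add: vec_eq_iff matrix_matrix_mult_def vector_matrix_mult_def mult.commute)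
    then have "N ** T = (\<chi> m. n \<cdot>\<^sub>H N $ m)"
      by (simp add: vec_eq_iff row)
    then show ?thesis
      by (auto simp: N_def vec_eq_iff)
  qed
  moreover have "det N = (f $ 1 \<cdot>\<^sub>H f $ 2) \<bullet> f $ 3"
    by (simp add: det_4 N_def quat_expand re algebra_simps)
  moreover have "det T = (n \<bullet> n)\<^sup>2"
    by (simp add: det_4 T_def qmult_def axis_def inner_vec_def sum_4) (simp add: power2_eq_square algebra_simps)
  ultimately show ?thesis
    by (simp add: det_mul mult.commute)
qed

text \<open>
  \<open>z\<close> anticommutes with \<open>x\<close> and with \<open>y\<close>, hence commutes with \<open>w = x \<cdot>\<^sub>H y\<close>. On the other hand
  \<open>w z + z w\<close> is real for imaginary \<open>w\<close> and \<open>z\<close>. So \<open>w \<cdot>\<^sub>H z\<close> is real, and multiplication by \<open>w\<close>, whose square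
  is \<open>- 1\<close>, shows that \<open>z\<close> is a multiple of \<open>w\<close>.
\<close>

lemma orthonormal_ImH_triple:
  assumes im: "x \<in> ImH" "y \<in> ImH" "z \<in> ImH"
    and orth: "x \<bullet> y = 0" "z \<bullet> x = 0" "z \<bullet> y = 0" and unit: "norm x = 1" "norm y = 1" "norm z = 1"
  shows "z = ((x \<cdot>\<^sub>H y) \<bullet> z) *\<^sub>R (x \<cdot>\<^sub>H y)" "\<bar>(x \<cdot>\<^sub>H y) \<bullet> z\<bar> = 1"
proof -
  let ?w = "x \<cdot>\<^sub>H y"
  have ac: "x \<cdot>\<^sub>H y = - (y \<cdot>\<^sub>H x)" "z \<cdot>\<^sub>H x = - (x \<cdot>\<^sub>H z)" "z \<cdot>\<^sub>H y = - (y \<cdot>\<^sub>H z)"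
    using ImH_anticommute[OF im(1,2)] ImH_anticommute[OF im(3,1)] ImH_anticommute[OF im(3,2)] orth
    by (simp_all add: eq_neg_iff_add_eq_0)
  have cj: "qcnj x = - x" "qcnj y = - y" "qcnj z = - z"
    using im by (simp_all add: ImH_iff)
  have w: "?w \<in> ImH"
    unfolding ImH_iff qcnj_qmult cj by (simp add: ac(1) qmult.minus_left qmult.minus_right)
  have nw: "?w \<bullet> ?w = 1"
    using unit by (simp add: dot_square_norm norm_qmult)
  have "z \<cdot>\<^sub>H ?w = (z \<cdot>\<^sub>H x) \<cdot>\<^sub>H y"
    by (simp only: qmult_assoc)
  also have "\<dots> = - (x \<cdot>\<^sub>H (z \<cdot>\<^sub>H y))"
    by (simp add: ac(2) qmult.minus_left qmult_assoc)
  also have "\<dots> = ?w \<cdot>\<^sub>H z"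
    by (simp add: ac(3) qmult.minus_right qmult_assoc)
  finally have comm: "z \<cdot>\<^sub>H ?w = ?w \<cdot>\<^sub>H z" .
  have "2 *\<^sub>R (?w \<cdot>\<^sub>H z) = (- 2 * (?w \<bullet> z)) *\<^sub>R qone"
    using ImH_anticommute[OF w im(3)] comm by (simp add: scaleR_2)
  also have "\<dots> = 2 *\<^sub>R (- (?w \<bullet> z) *\<^sub>R qone)"
    by simp
  finally have wz: "?w \<cdot>\<^sub>H z = - (?w \<bullet> z) *\<^sub>R qone"
    by (simp only: scaleR_cancel_left) simp
  have "- z = ?w \<cdot>\<^sub>H (?w \<cdot>\<^sub>H z)"
    using ImH_qmult_self[OF w] nw by (simp add: qmult_assoc [of ?w, symmetric] qmult.minus_left)
  also have "\<dots> = - (?w \<bullet> z) *\<^sub>R ?w"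
    by (simp only: wz qmult.scaleR_right qone_qmult)
  finally show z: "z = (?w \<bullet> z) *\<^sub>R ?w"
    by simp
  have "norm ?w = 1"
    using unit by (simp add: norm_qmult)
  then show "\<bar>?w \<bullet> z\<bar> = 1"
    using unit(3) arg_cong[OF z, of norm] by simp
qed

text \<open>
  In the trivialization, oriented orthonormal frames of the tangent space are oriented triads. The triple
  product of an orthonormal triad is \<open>1\<close> or \<open>- 1\<close>, so its sign decides whether
  \<open>f $ 1 \<cdot>\<^sub>H f $ 2\<close> is \<open>f $ 3\<close> or its negative.
\<close>

lemma oriented_frame_bundle_iff:
  assumes "oriented_hypersurface \<Sigma> \<nu>"
  shows "(p, e) \<in> oriented_frame_bundle \<Sigma> \<nu> \<longleftrightarrow>
    p \<in> \<Sigma> \<and> oriented_triad (\<chi> m. qcnj (\<nu> p) \<cdot>\<^sub>H e $ m)"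
proof (cases "p \<in> \<Sigma>")
  case False
  then show ?thesis by (simp add: oriented_frame_bundle_def)
next
  case True
  then have n: "norm (\<nu> p) = 1"
    using assms by (simp add: oriented_hypersurface_def)
  define f where "f = (\<chi> m. qcnj (\<nu> p) \<cdot>\<^sub>H e $ m)"
  have e: "e $ m = \<nu> p \<cdot>\<^sub>H f $ m" for m
    by (simp add: f_def unit_qmult_cancel n)
  have tan: "e $ m \<in> tangent_space \<Sigma> p \<longleftrightarrow> f $ m \<in> ImH" for m
    by (simp add: tangent_space_eq_hyperplane[OF assms True] f_def ImH_def qRe_qcnj_qmult)
  have inn: "e $ m \<bullet> e $ k = f $ m \<bullet> f $ k" for m k
    by (simp add: e inner_unit_qmult n)
  have det: "det ((\<chi> m. if m = 1 then \<nu> p else if m = 2 then e $ 1 else if m = 3 then e $ 2 else e $ 3)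
          :: real^4^4) = (f $ 1 \<cdot>\<^sub>H f $ 2) \<bullet> f $ 3" if "\<And>m. f $ m \<in> ImH"
    unfolding e using det_frame[OF that, of "\<nu> p"] n by (simp add: dot_square_norm)
  have "(f $ 1 \<cdot>\<^sub>H f $ 2) \<bullet> f $ 3 > 0 \<longleftrightarrow> f $ 1 \<cdot>\<^sub>H f $ 2 = f $ 3"
    if im: "\<And>m. f $ m \<in> ImH" and orth: "\<And>m n. f $ m \<bullet> f $ n = (if m = n then 1 else 0)"
  proof -
    have "norm (f $ m) = 1" for m
      using orth[of m m] by (simp add: norm_eq_sqrt_inner)
    then have "f $ 3 = ((f $ 1 \<cdot>\<^sub>H f $ 2) \<bullet> f $ 3) *\<^sub>R (f $ 1 \<cdot>\<^sub>H f $ 2)" "\<bar>(f $ 1 \<cdot>\<^sub>H f $ 2) \<bullet> f $ 3\<bar> = 1"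
      using orthonormal_ImH_triple[of "f $ 1" "f $ 2" "f $ 3"] im orth by auto
    then show ?thesis
      using orth[of 3 3] by (metis abs_of_pos scaleR_one zero_less_one)
  qed
  then show ?thesis
    unfolding f_def [symmetric] oriented_frame_bundle_def oriented_triad_def
    using True by (auto simp: tan inn det)
qed

section \<open>The spin structure\<close>

definition spin_frame :: "(quat \<Rightarrow> quat) \<Rightarrow> quat \<times> quat \<Rightarrow> quat \<times> (quat^3)" where
  "spin_frame \<nu> u = (fst u, \<chi> m. \<nu> (fst u) \<cdot>\<^sub>H rotated_triad (snd u) $ m)"

text \<open>
  The columns of \<open>spin_cover h\<close> are the triad rotated by \<open>h\<close>, so acting with this matrix on the triad rotated by \<open>g\<close>
  applies the conjugation by \<open>g\<close> to the triad rotated by \<open>h\<close>.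
\<close>

lemma frame_act_spin_cover:
  "frame_act (spin_frame \<nu> (p, g)) (spin_cover h) = spin_frame \<nu> (p, g \<cdot>\<^sub>H h)"
proof -
  have "(\<Sum>m\<in>UNIV. spin_cover h $ m $ n *\<^sub>R (g \<cdot>\<^sub>H qunit m \<cdot>\<^sub>H qcnj g)) = rotated_triad (g \<cdot>\<^sub>H h) $ n" for n
  proof -
    let ?y = "h \<cdot>\<^sub>H qunit n \<cdot>\<^sub>H qcnj h"
    have "?y \<in> ImH"
      using qunit_triad(1)[of n]
      by (simp add: ImH_iff qcnj_qmult qmult_assoc qmult.minus_left qmult.minus_right del: qunit_simps)
    then have y: "(\<Sum>m\<in>UNIV. im_part ?y $ m *\<^sub>R qunit m) = ?y"
      by (simp add: ImH_def qRe_def sum_3 im_part_def vec_eq_iff forall_4)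
    have "spin_cover h $ m $ n = im_part ?y $ m" for m
      by (simp add: spin_cover_def matrix_def qunit_def)
    then have "(\<Sum>m\<in>UNIV. spin_cover h $ m $ n *\<^sub>R (g \<cdot>\<^sub>H qunit m \<cdot>\<^sub>H qcnj g)) =
        g \<cdot>\<^sub>H (\<Sum>m\<in>UNIV. im_part ?y $ m *\<^sub>R qunit m) \<cdot>\<^sub>H qcnj g"
      by (simp add: qmult.sum_left qmult.sum_right qmult.scaleR_left qmult.scaleR_right del: qunit_simps)
    then show ?thesis
      unfolding y by (simp add: rotated_triad_def qcnj_qmult qmult_assoc del: qunit_simps)
  qed
  then have "(\<Sum>m\<in>UNIV. spin_cover h $ m $ n *\<^sub>R (\<nu> p \<cdot>\<^sub>H rotated_triad g $ m)) =
      \<nu> p \<cdot>\<^sub>H rotated_triad (g \<cdot>\<^sub>H h) $ n" for n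
    by (simp add: qmult.sum_right [symmetric] qmult.scaleR_right [symmetric] rotated_triad_def del: qunit_simps)
  then show ?thesis
    by (simp add: frame_act_def spin_frame_def vec_eq_iff)
qed

lemma spin_frame_inverse:
  assumes "norm (\<nu> p) = 1"
  shows "(\<chi> m. qcnj (\<nu> p) \<cdot>\<^sub>H snd (spin_frame \<nu> (p, g)) $ m) = rotated_triad g"
  by (simp add: spin_frame_def unit_qmult_cancel assms vec_eq_iff)

lemma spin_frame_eq_iff:
  assumes "norm (\<nu> p) = 1" "norm g = 1" "norm h = 1"
  shows "spin_frame \<nu> (p, g) = spin_frame \<nu> (q, h) \<longleftrightarrow> p = q \<and> (g = h \<or> g = - h)"
proof -
  have "rotated_triad g = rotated_triad h" if "spin_frame \<nu> (p, g) = spin_frame \<nu> (p, h)"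
    using that spin_frame_inverse[of \<nu> p] assms(1) by metis
  then have "spin_frame \<nu> (p, g) = spin_frame \<nu> (p, h) \<longleftrightarrow> rotated_triad g = rotated_triad h"
    by (auto simp: spin_frame_def)
  then show ?thesis
    using rotated_triad_eq_iff[OF assms(2,3)] by (auto simp: spin_frame_def)
qed

lemma spin_frame_image:
  assumes or: "oriented_hypersurface \<Sigma> \<nu>"
  shows "spin_frame \<nu> ` (\<Sigma> \<times> Spin3) = oriented_frame_bundle \<Sigma> \<nu>"
proof -
  have n: "norm (\<nu> p) = 1" if "p \<in> \<Sigma>" for p
    using or that by (simp add: oriented_hypersurface_def)
  have "spin_frame \<nu> (p, g) \<in> oriented_frame_bundle \<Sigma> \<nu>" if "p \<in> \<Sigma>" "norm g = 1" for p g
    using spin_frame_inverse[where \<nu> = \<nu>, OF n[OF that(1)], of g] that oriented_triad_rotated_triad[OF that(2)]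
      oriented_frame_bundle_iff[OF or, of p "snd (spin_frame \<nu> (p, g))"]
    by (simp add: spin_frame_def)
  moreover have "(p, e) \<in> spin_frame \<nu> ` (\<Sigma> \<times> Spin3)" if "(p, e) \<in> oriented_frame_bundle \<Sigma> \<nu>" for p e
  proof -
    have p: "p \<in> \<Sigma>" and "oriented_triad (\<chi> m. qcnj (\<nu> p) \<cdot>\<^sub>H e $ m)"
      using that oriented_frame_bundle_iff[OF or] by auto
    then obtain g where g: "norm g = 1" "(\<chi> m. qcnj (\<nu> p) \<cdot>\<^sub>H e $ m) = rotated_triad g"
      using oriented_triad_imp_rotated by blast
    have "spin_frame \<nu> (p, g) = (p, e)"
      by (simp add: spin_frame_def g(2) [symmetric] unit_qmult_cancel n p vec_eq_iff)
    then show ?thesis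
      using p g(1) by (intro image_eqI[of _ _ "(p, g)"]) (auto simp: Spin3_def)
  qed
  ultimately show ?thesis
    by (auto simp: Spin3_def)
qed

lemma smooth_spin_frame:
  assumes or: "oriented_hypersurface \<Sigma> \<nu>"
  shows "smooth_map (\<Sigma> \<times> Spin3) (spin_frame \<nu>)"
proof -
  have "smooth_map \<Sigma> \<nu>"
    using or by (simp add: oriented_hypersurface_def)
  then have "smooth_map (\<Sigma> \<times> Spin3) (\<lambda>z. \<nu> (fst z))"
    by (rule smooth_map_compose_fst) auto
  then have "smooth_map (\<Sigma> \<times> Spin3)
      (\<lambda>u. (fst u, \<chi> m. \<nu> (fst u) \<cdot>\<^sub>H (snd u \<cdot>\<^sub>H qunit m \<cdot>\<^sub>H qcnj (snd u))))"
    by (intro smooth_map_Pair smooth_map_fst smooth_map_vec smooth_map_const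
        smooth_map_qmult smooth_map_qcnj smooth_map_snd)
  then show ?thesis
    by (simp add: spin_frame_def [abs_def] rotated_triad_def del: qunit_simps)
qed

text \<open>
  Around the frame of \<open>g\<^sub>0\<close>, the averages with parameter \<open>g\<^sub>0\<close> are nonzero on an open set \<open>T\<close>. Above \<open>T\<close> lie the two open
  hemispheres \<open>g \<bullet> g\<^sub>0 > 0\<close> and \<open>g \<bullet> g\<^sub>0 < 0\<close>. As the average of the frame of \<open>g\<close> is \<open>4 (g \<bullet> g\<^sub>0) g\<close>, its normalization,
  with the sign of the hemisphere, inverts the projection on each of them.
\<close>

lemma covering_space_spin_frame:
  assumes or: "oriented_hypersurface \<Sigma> \<nu>"
  shows "covering_space (\<Sigma> \<times> Spin3) (spin_frame \<nu>) (oriented_frame_bundle \<Sigma> \<nu>)"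
proof
  let ?P = "\<Sigma> \<times> Spin3" and ?FB = "oriented_frame_bundle \<Sigma> \<nu>"
  have n: "norm (\<nu> p) = 1" if "p \<in> \<Sigma>" for p
    using or that by (simp add: oriented_hypersurface_def)
  show cont: "continuous_on ?P (spin_frame \<nu>)"
    using smooth_spin_frame[OF or] by (rule smooth_map_imp_continuous_on)
  show image: "spin_frame \<nu> ` ?P = ?FB"
    using or by (rule spin_frame_image)
  fix f\<^sub>0 assume "f\<^sub>0 \<in> ?FB"
  then obtain p\<^sub>0 g\<^sub>0 where f\<^sub>0: "f\<^sub>0 = spin_frame \<nu> (p\<^sub>0, g\<^sub>0)" "p\<^sub>0 \<in> \<Sigma>" "norm g\<^sub>0 = 1"
    unfolding image [symmetric] by (auto simp: Spin3_def)
  define K where "K f = triad_avg (\<chi> m. qcnj (\<nu> (fst f)) \<cdot>\<^sub>H snd f $ m) g\<^sub>0" for f :: "quat \<times> (quat^3)"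
  have K: "K (spin_frame \<nu> (p, g)) = (4 * (g \<bullet> g\<^sub>0)) *\<^sub>R g" if "p \<in> \<Sigma>" "norm g = 1" for p g
    using triad_avg_rotated_triad[OF that(2)] spin_frame_inverse[where \<nu> = \<nu>, OF n[OF that(1)]]
    by (simp add: K_def) (simp add: spin_frame_def)
  have contK: "continuous_on ?FB K"
  proof -
    have "continuous_on \<Sigma> \<nu>"
      using or by (simp add: oriented_hypersurface_def smooth_map_imp_continuous_on)
    then have "continuous_on ?FB (\<lambda>f. \<nu> (fst f))"
      by (rule continuous_on_compose2) (auto intro: continuous_intros simp: oriented_frame_bundle_def)
    then show ?thesis
      unfolding K_def triad_avg_def vec_lambda_beta
      by (intro continuous_on_add continuous_on_sum continuous_on_const continuous_on_snd continuous_on_id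
          bounded_bilinear.continuous_on[OF qmult.bounded_bilinear_axioms]
          bounded_linear.continuous_on[OF bounded_linear_qcnj] continuous_on_component)
  qed
  define T where "T = ?FB \<inter> K -` (- {0})"
  define V where "V s = ?P \<inter> {u. s * (snd u \<bullet> g\<^sub>0) > 0}" for s :: real
  define q where "q s f = (fst f, s *\<^sub>R sgn (K f))" for s :: real and f
  have mem_T: "spin_frame \<nu> u \<in> T \<longleftrightarrow> snd u \<bullet> g\<^sub>0 \<noteq> 0" if "u \<in> ?P" for u
    using K[of "fst u" "snd u"] imageI[OF that, of "spin_frame \<nu>", unfolded image] that
    by (auto simp: T_def Spin3_def)
  have f\<^sub>0_T: "f\<^sub>0 \<in> T"
    using \<open>f\<^sub>0 \<in> ?FB\<close> K[OF f\<^sub>0(2,3)] f\<^sub>0 by (auto simp: T_def dot_square_norm)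
  have open_T: "openin (top_of_set ?FB) T"
    unfolding T_def using contK by (intro continuous_openin_preimage_gen) auto
  have Un_V: "\<Union>(V ` {1, -1}) = ?P \<inter> spin_frame \<nu> -` T"
  proof -
    have "\<Union>(V ` {1, -1}) = {u \<in> ?P. snd u \<bullet> g\<^sub>0 \<noteq> 0}"
      by (auto simp: V_def)
    then show ?thesis
      using mem_T by blast
  qed
  have open_V: "openin (top_of_set ?P) (V s)" for s
  proof -
    have "open {u :: quat \<times> quat. s * (snd u \<bullet> g\<^sub>0) > 0}"
      by (intro open_Collect_less continuous_intros)
    then show ?thesis
      unfolding V_def by (rule openin_open_Int)
  qed
  have disj_V: "pairwise disjnt (V ` {1, -1})"
    by (auto simp: pairwise_def disjnt_def V_def)
  have homeo: "homeomorphism (V s) T (spin_frame \<nu>) (q s)" if s: "s \<in> {1, -1}" for s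
  proof
    show "continuous_on (V s) (spin_frame \<nu>)"
      using cont by (rule continuous_on_subset) (auto simp: V_def)
    have "continuous_on T K"
      using contK by (rule continuous_on_subset) (auto simp: T_def)
    then show "continuous_on T (q s)"
      unfolding q_def
      by (intro continuous_on_Pair continuous_on_fst continuous_on_id continuous_on_scaleR continuous_on_const
          continuous_on_sgn) (auto simp: T_def)
    \<comment> \<open>The radial factor \<open>4 (g \<bullet> g\<^sub>0)\<close> of the average survives normalization as a sign only.\<close>
    have q: "q s (spin_frame \<nu> (p, g)) = (p, (s * sgn (g \<bullet> g\<^sub>0)) *\<^sub>R g)" if "p \<in> \<Sigma>" "norm g = 1" for p g
      using K[OF that] that(2) by (simp add: q_def spin_frame_def sgn_scaleR sgn_mult sgn_div_norm[of g])
    show "spin_frame \<nu> ` V s \<subseteq> T"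
      using mem_T by (auto simp: V_def)
    have T: "\<exists>p g. f = spin_frame \<nu> (p, g) \<and> p \<in> \<Sigma> \<and> norm g = 1 \<and> g \<bullet> g\<^sub>0 \<noteq> 0" if f: "f \<in> T" for f
    proof -
      obtain p g where "f = spin_frame \<nu> (p, g)" "p \<in> \<Sigma>" "norm g = 1"
        using f unfolding T_def image [symmetric] by (auto simp: Spin3_def)
      moreover from this have "g \<bullet> g\<^sub>0 \<noteq> 0"
        using f K[of p g] by (auto simp: T_def)
      ultimately show ?thesis by blast
    qed
    show "q s (spin_frame \<nu> u) = u" if "u \<in> V s" for u
    proof -
      have "s * sgn (snd u \<bullet> g\<^sub>0) = 1"
        using that s by (auto simp: V_def)
      then show ?thesis
        using that q[of "fst u" "snd u"] by (auto simp: V_def Spin3_def)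
    qed
    have "q s f \<in> V s \<and> spin_frame \<nu> (q s f) = f" if "f \<in> T" for f
    proof -
      obtain p g where f: "f = spin_frame \<nu> (p, g)" "p \<in> \<Sigma>" "norm g = 1" "g \<bullet> g\<^sub>0 \<noteq> 0"
        using T[OF \<open>f \<in> T\<close>] by blast
      have c: "s * sgn (g \<bullet> g\<^sub>0) = 1 \<or> s * sgn (g \<bullet> g\<^sub>0) = -1"
        using s f(4) by (auto simp: sgn_if)
      have "s * ((s * sgn (g \<bullet> g\<^sub>0)) * (g \<bullet> g\<^sub>0)) > 0"
        using s f(4) by (auto simp: sgn_if)
      then have "q s f \<in> V s"
        using f c by (auto simp: q V_def Spin3_def)
      moreover have "spin_frame \<nu> (q s f) = f"
        using c f spin_frame_eq_iff[of \<nu> p "- g" g p] n by (auto simp: q)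
      ultimately show ?thesis ..
    qed
    then show "q s ` T \<subseteq> V s" "\<And>f. f \<in> T \<Longrightarrow> spin_frame \<nu> (q s f) = f"
      by auto
  qed
  show "\<exists>T. f\<^sub>0 \<in> T \<and> openin (top_of_set ?FB) T \<and> (\<exists>v. \<Union>v = ?P \<inter> spin_frame \<nu> -` T \<and>
      (\<forall>u\<in>v. openin (top_of_set ?P) u) \<and> pairwise disjnt v \<and> (\<forall>u\<in>v. \<exists>q. homeomorphism u T (spin_frame \<nu>) q))"
  proof (rule exI[of _ T], intro conjI exI[of _ "V ` {1, -1}"] ballI)
    fix W assume "W \<in> V ` {1, -1}"
    then obtain s where "W = V s" "s \<in> {1, -1}" by blast
    then show "openin (top_of_set ?P) W" "\<exists>q. homeomorphism W T (spin_frame \<nu>) q"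
      using open_V homeo by blast+
  qed (fact f\<^sub>0_T open_T Un_V disj_V)+
qed

lemma trivial_principal_Spin3_bundle:
  "principal_Spin3_bundle \<Sigma> (\<Sigma> \<times> Spin3) fst (\<lambda>(p, g) h. (p, g \<cdot>\<^sub>H h))"
proof -
  have "smooth_map ((\<Sigma> \<times> Spin3) \<times> Spin3) (\<lambda>z. (fst (fst z), snd (fst z) \<cdot>\<^sub>H snd z))"
    by (intro smooth_map_Pair smooth_map_qmult smooth_map_snd
        smooth_map_linear_comp[OF bounded_linear_fst smooth_map_fst]
        smooth_map_linear_comp[OF bounded_linear_snd smooth_map_fst])
  then have 1: "smooth_map ((\<Sigma> \<times> Spin3) \<times> Spin3) (\<lambda>(u, h). (\<lambda>(p, g) h. (p, g \<cdot>\<^sub>H h)) u h)"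
    by (simp add: case_prod_unfold)
  have 2: "fst ` (\<Sigma> \<times> Spin3) = \<Sigma>"
  proof -
    have "qone \<in> Spin3"
      by (simp add: Spin3_def norm_eq_sqrt_inner quat_expand)
    then show ?thesis by force
  qed
  have 3: "diffeomorphism ((\<Sigma> \<times> Spin3) \<inter> fst -` \<Sigma>) (\<Sigma> \<times> Spin3) (\<lambda>u. u) (\<lambda>u. u)"
    unfolding diffeomorphism_def using smooth_map_linear[OF bounded_linear_ident] by auto
  show ?thesis
    unfolding principal_Spin3_bundle_def
  proof (intro conjI ballI)
    show "\<exists>U \<Phi> \<Psi>. b \<in> U \<and> openin (top_of_set \<Sigma>) U \<and>
        diffeomorphism ((\<Sigma> \<times> Spin3) \<inter> fst -` U) (U \<times> Spin3) \<Phi> \<Psi> \<and>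
        (\<forall>u\<in>(\<Sigma> \<times> Spin3) \<inter> fst -` U. fst (\<Phi> u) = fst u \<and>
           (\<forall>g\<in>Spin3. snd (\<Phi> ((\<lambda>(p, g) h. (p, g \<cdot>\<^sub>H h)) u g)) = snd (\<Phi> u) \<cdot>\<^sub>H g))" if "b \<in> \<Sigma>" for b
      using that 3
      by (intro exI[of _ \<Sigma>] exI[of _ "\<lambda>u. u"]) auto
  qed (use 1 2 smooth_map_fst in \<open>auto simp: Spin3_def norm_qmult qmult_assoc\<close>)
qed

lemma spin_structure_spin_frame:
  assumes or: "oriented_hypersurface \<Sigma> \<nu>"
  shows "spin_structure \<Sigma> \<nu> (\<Sigma> \<times> Spin3) fst (\<lambda>(p, g) h. (p, g \<cdot>\<^sub>H h)) (spin_frame \<nu>)"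
  unfolding spin_structure_def
proof (intro conjI ballI)
  show "card {u \<in> \<Sigma> \<times> Spin3. spin_frame \<nu> u = f} = 2" if fb: "f \<in> oriented_frame_bundle \<Sigma> \<nu>" for f
  proof -
    obtain p g where f: "f = spin_frame \<nu> (p, g)" "p \<in> \<Sigma>" "norm g = 1"
      using fb unfolding spin_frame_image[OF or, symmetric] by (auto simp: Spin3_def)
    have "norm (\<nu> x) = 1" if "x \<in> \<Sigma>" for x
      using or that by (simp add: oriented_hypersurface_def)
    then have "{u \<in> \<Sigma> \<times> Spin3. spin_frame \<nu> u = f} = {(p, g), (p, - g)}"
      using f spin_frame_eq_iff[of \<nu>] by (auto simp: Spin3_def)
    moreover have "g \<noteq> - g"
    proof
      assume "g = - g"
      then have "2 *\<^sub>R g = 0" by (simp add: scaleR_2 eq_neg_iff_add_eq_0)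
      then show False using f(3) by simp
    qed
    ultimately show ?thesis by simp
  qed
  show "spin_frame \<nu> ((\<lambda>(p, g) h. (p, g \<cdot>\<^sub>H h)) u h) = frame_act (spin_frame \<nu> u) (spin_cover h)" for u h
    by (cases u) (simp add: frame_act_spin_cover)
qed (use trivial_principal_Spin3_bundle smooth_spin_frame[OF or] covering_space_spin_frame[OF or] in \<open>auto simp: spin_frame_def\<close>)

section \<open>The theorem\<close>

theorem mainTheorem11:
  fixes \<Sigma> :: "quat set" and \<nu> :: "quat \<Rightarrow> quat"
  assumes "oriented_hypersurface \<Sigma> \<nu>"
  shows
    "(\<forall>p\<in>\<Sigma>. isometric_isomorphism (tangent_space \<Sigma> p) ImH (\<lambda>v. qcnj (\<nu> p) \<cdot>\<^sub>H v)) \<and>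
     (\<forall>p\<in>\<Sigma>. \<forall>v\<in>tangent_space \<Sigma> p. (\<lambda>q. qcnj (\<nu> p) \<cdot>\<^sub>H v \<cdot>\<^sub>H q) \<in> carrier (End_H (\<cdot>\<^sub>H))) \<and>
     (\<exists>\<rho> :: quat \<Rightarrow> (quat list \<Rightarrow> real) set \<Rightarrow> quat \<Rightarrow> quat.
        (\<forall>p\<in>\<Sigma>. \<forall>v\<in>tangent_space \<Sigma> p.
           \<rho> p (clifford_vec (tangent_space \<Sigma> p) (\<bullet>) v) = (\<lambda>q. qcnj (\<nu> p) \<cdot>\<^sub>H v \<cdot>\<^sub>H q)) \<and>
        irreducible_clifford_bimodule_bundle \<Sigma> \<rho> (\<cdot>\<^sub>H) \<and>
        inner_product qmetric \<and>
        (\<forall>p\<in>\<Sigma>. \<forall>v\<in>tangent_space \<Sigma> p.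
           skew_adjoint qmetric (\<rho> p (clifford_vec (tangent_space \<Sigma> p) (\<bullet>) v))) \<and>
        (\<forall>h\<in>ImH. skew_adjoint qmetric (\<lambda>q. q \<cdot>\<^sub>H h))) \<and>
     (\<exists>(P :: (quat \<times> quat) set) \<pi> act \<eta>. spin_structure \<Sigma> \<nu> P \<pi> act \<eta>) \<and>
     global_trivialization \<Sigma> ImH (\<lambda>p v. qcnj (\<nu> p) \<cdot>\<^sub>H v)"
proof (intro conjI)
  note iso = tangent_isometry[OF assms]
  show "\<forall>p\<in>\<Sigma>. isometric_isomorphism (tangent_space \<Sigma> p) ImH (\<lambda>v. qcnj (\<nu> p) \<cdot>\<^sub>H v)"
    using iso by blast
  show "\<forall>p\<in>\<Sigma>. \<forall>v\<in>tangent_space \<Sigma> p. (\<lambda>q. qcnj (\<nu> p) \<cdot>\<^sub>H v \<cdot>\<^sub>H q) \<in> carrier (End_H (\<cdot>\<^sub>H))"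
    using left_mult_End_H by blast
  show "\<exists>(P :: (quat \<times> quat) set) \<pi> act \<eta>. spin_structure \<Sigma> \<nu> P \<pi> act \<eta>"
    using spin_structure_spin_frame[OF assms] by blast
  show "global_trivialization \<Sigma> ImH (\<lambda>p v. qcnj (\<nu> p) \<cdot>\<^sub>H v)"
    using assms by (rule trivialization_by_normal)
  obtain \<rho> where \<rho>: "\<And>p v. p \<in> \<Sigma> \<Longrightarrow> v \<in> tangent_space \<Sigma> p \<Longrightarrow>
      \<rho> p (clifford_vec (tangent_space \<Sigma> p) (\<bullet>) v) = (\<lambda>q. qcnj (\<nu> p) \<cdot>\<^sub>H v \<cdot>\<^sub>H q)"
    "\<And>p. p \<in> \<Sigma> \<Longrightarrow> irreducible_clifford_bimodule (tangent_space \<Sigma> p) (\<bullet>) (\<rho> p) (\<cdot>\<^sub>H)"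
    using clifford_action[OF assms] by metis
  have "smooth_map {(p, v, x). p \<in> \<Sigma> \<and> v \<in> tangent_space \<Sigma> p}
       (\<lambda>(p, v, x). \<rho> p (clifford_vec (tangent_space \<Sigma> p) (\<bullet>) v) x)"
    by (rule smooth_map_cong[THEN iffD2, OF _ smooth_clifford_multiplication[OF assms]]) (auto simp: \<rho>)
  then have "irreducible_clifford_bimodule_bundle \<Sigma> \<rho> (\<cdot>\<^sub>H)"
    by (simp add: irreducible_clifford_bimodule_bundle_def \<rho>(2))
  moreover have "skew_adjoint qmetric (\<rho> p (clifford_vec (tangent_space \<Sigma> p) (\<bullet>) v))"
    if "p \<in> \<Sigma>" "v \<in> tangent_space \<Sigma> p" for p v
  proof -
    have "qcnj (\<nu> p) \<cdot>\<^sub>H v \<in> ImH"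
      using iso[OF that(1)] that(2) by (auto simp: isometric_isomorphism_def bij_betw_def)
    then show ?thesis
      by (simp only: \<rho>(1)[OF that] skew_adjoint_ImH_mult(1))
  qed
  ultimately show "\<exists>\<rho> :: quat \<Rightarrow> (quat list \<Rightarrow> real) set \<Rightarrow> quat \<Rightarrow> quat.
        (\<forall>p\<in>\<Sigma>. \<forall>v\<in>tangent_space \<Sigma> p.
           \<rho> p (clifford_vec (tangent_space \<Sigma> p) (\<bullet>) v) = (\<lambda>q. qcnj (\<nu> p) \<cdot>\<^sub>H v \<cdot>\<^sub>H q)) \<and>
        irreducible_clifford_bimodule_bundle \<Sigma> \<rho> (\<cdot>\<^sub>H) \<and>
        inner_product qmetric \<and>
        (\<forall>p\<in>\<Sigma>. \<forall>v\<in>tangent_space \<Sigma> p.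
           skew_adjoint qmetric (\<rho> p (clifford_vec (tangent_space \<Sigma> p) (\<bullet>) v))) \<and>
        (\<forall>h\<in>ImH. skew_adjoint qmetric (\<lambda>q. q \<cdot>\<^sub>H h))"
    using \<rho>(1) inner_product_qmetric skew_adjoint_ImH_mult(2) by (intro exI[of _ \<rho>]) blast
qed

end
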